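(* Let $f_1,\dots,f_n:\mathbb{R}^d\to\mathbb{R}$ be convex and differentiable, with $\nabla f_i$ being $L_i$-Lipschitz in the Euclidean norm, let $L_{\max}=\max\{L_1,\dots,L_n\}>0$, let $R:\mathbb{R}^d\to\mathbb{R}$ be $\mu$-strongly convex with $\mu\ge0$ ($\mu=0$, i.e. $R$ merely convex, is allowed), and suppose that $P=\frac1n\sum_{i=1}^n f_i+R$ has a minimizer $x_*$. Let $\widetilde x_0\in\mathbb{R}^d$, $\eta=5L_{\max}$, $m_1,S\in\mathbb{N}$ positive, and $\alpha=0$. Then the iterates of the SADA algorithm for non-strongly convex regularizers (defined in the context, with $m_s=2^{s-1}m_1$) satisfy $$\mathbb{E}[P(\widetilde x_S)-P(x_* )]\le\frac1{2^S}\Big[P(\widetilde x_0)-P(x_* )+\frac{5L_{\max}}{m_1}\|\widetilde x_0-x_*\|^2\Big].$$ In addition, if $m_1=O(L_{\max})$, then SADA has gradient complexity (defined in the context) $O\big(n\log\frac1\varepsilon+\frac{L_{\max}}{\varepsilon}\big)$ for $\mathbb{E}[P(\widetilde x_S)-P(x_* )]\le\varepsilon$. That is, if $m_1\le cL_{\max}$, then, with $D=P(\widetilde x_0)-P(x_* )+\frac{5L_{\max}}{m_1}\|\widetilde x_0-x_*\|^2$, there is a constant $C$ depending only on $c$ and $D$ such that for every $\varepsilon\in(0,\frac12]$ there is $S\ge1$ for which $\mathbb{E}[P(\widetilde x_S)-P(x_* )]\le\varepsilon$ and the number of component gradient evaluations used in the first $S$ stages is at most $C\big(n\log\frac1\v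arepsilon+\frac{L_{\max}}{\varepsilon}\big)$.
   Context: All norms are Euclidean. $F=\frac1n\sum_{i=1}^n f_i$ and $P=F+R$. $R$ is $\mu$-strongly convex ($\mu\ge0$) means $R(y)\ge R(x)+\xi^\top(y-x)+\frac{\mu}{2}\|y-x\|^2$ for all $x,y\in\mathbb{R}^d$ and all $\xi\in\partial R(x)$. SADA algorithm (non-strongly convex version) with inputs $\widetilde x_0\in\mathbb{R}^d$, $\eta>0$, $m_1$, and $\alpha$: set $\widetilde v_0=\widetilde x_0$. For stages $s=1,2,\dots$: put $x_0=\widetilde x_{s-1}$, $v_0=(1-\alpha)\widetilde v_{s-1}+\alpha\widetilde x_{s-1}$ (so $v_0=\widetilde v_{s-1}$ when $\alpha=0$), $u_0=v_0$, $\bar g_0=0$, $\phi_i^0=x_0$ for $i=1,\dots,n$, and $m_s=2^{s-1}m_1$. For $t=1,\dots,m_s$: draw $i_t$ uniformly from $\{1,\dots,n\}$ independently of all earlier draws (in this and previous stages), set $\phi_{i_t}^t=u_{t-1}$ and $\phi_i^t=\phi_i^{t-1}$ for $i\ne i_t$, and $$g_t=\nabla f_{i_t}(\phi_{i_t}^t)-\nabla f_{i_t}(\phi_{i_t}^{t-1})+\frac1n\sum_{i=1}^n\nabla f_i(\phi_i^{t-1}),\qquad \bar g_t=\Big(1-\frac1t\Big)\bar g_{t-1}+\frac1t g_t,$$ $$v_t=\operatorname*{argmin}_{x\in\mathbb{R}^d}\Big\{\langle\bar g_t,x\rangle+R(x)+\frac{\eta}{2t}\|x-v_0\|^2\Big\},\qquad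 x_t=\operatorname*{argmin}_{x\in\mathbb{R}^d}\Big\{\langle g_t,x\rangle+R(x)+\frac{\eta t}{2}\|x-u_{t-1}\|^2\Big\},$$ $$u_t=\Big(1-\frac1{t+1}\Big)x_t+\frac1{t+1}v_t .$$ Finally put $\widetilde x_s=x_{m_s}$ and $\widetilde v_s=v_{m_s}$. The expectation $\mathbb{E}$ is over all random draws. Gradient complexity is the order of the number of evaluations of component gradients $\nabla f_i$ needed to reach the stated accuracy; the average $\frac1n\sum_i\nabla f_i(\phi_i^{t})$ is computed once at the start of a stage ($n$ evaluations) and then updated incrementally, and each inner iteration uses $2$ evaluations, so stage $s$ costs $n+2m_s$ and $S$ stages cost $\sum_{s=1}^S(n+2m_s)$. *)

theory Defs
  imports
    "HOL-Analysis.Analysis"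
    "HOL-Probability.Probability_Mass_Function"
    "HOL-Library.Poly_Mapping"
begin

section \<open>Euclidean spaces of variable dimension\<close>

text \<open>
  The complexity bound involves a constant that is independent of the dimension, so the
  dimension has to be quantified inside the formula and cannot be a type.  We therefore let
  \<open>d\<close>-dimensional Euclidean space be the space of all finitely supported real sequences
  that vanish outside \<open>{..<d}\<close>.  The finitely supported functions are made an inner
  product space, so that the notions of the library (norm, derivative, convexity,
  Lipschitz continuity), relativised to this subspace, apply.
\<close>

instantiation poly_mapping :: (type, real_inner) real_inner
begin

definition scaleR_poly_mapping :: "real \<Rightarrow> ('a \<Rightarrow>\<^sub>0 'b) \<Rightarrow> ('a \<Rightarrow>\<^sub>0 'b)" where
  "scaleR_poly_mapping c x = Poly_Mapping.map (scaleR c) x"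

definition inner_poly_mapping :: "('a \<Rightarrow>\<^sub>0 'b) \<Rightarrow> ('a \<Rightarrow>\<^sub>0 'b) \<Rightarrow> real" where
  "inner_poly_mapping x y =
     (\<Sum>k\<in>Poly_Mapping.keys x. inner (Poly_Mapping.lookup x k) (Poly_Mapping.lookup y k))"

definition norm_poly_mapping :: "('a \<Rightarrow>\<^sub>0 'b) \<Rightarrow> real" where
  "norm_poly_mapping x = sqrt (inner x x)"

definition sgn_poly_mapping :: "('a \<Rightarrow>\<^sub>0 'b) \<Rightarrow> ('a \<Rightarrow>\<^sub>0 'b)" where
  "sgn_poly_mapping x = inverse (norm x) *\<^sub>R x"

definition dist_poly_mapping :: "('a \<Rightarrow>\<^sub>0 'b) \<Rightarrow> ('a \<Rightarrow>\<^sub>0 'b) \<Rightarrow> real" where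
  "dist_poly_mapping x y = norm (x - y)"

definition uniformity_poly_mapping :: "(('a \<Rightarrow>\<^sub>0 'b) \<times> ('a \<Rightarrow>\<^sub>0 'b)) filter" where
  "uniformity_poly_mapping = (INF e\<in>{0<..}. principal {(x, y). dist x y < e})"

definition open_poly_mapping :: "('a \<Rightarrow>\<^sub>0 'b) set \<Rightarrow> bool" where
  "open_poly_mapping U \<longleftrightarrow> (\<forall>x\<in>U. eventually (\<lambda>(x', y). x' = x \<longrightarrow> y \<in> U) uniformity)"

instance
proof
  have look: "Poly_Mapping.lookup (c *\<^sub>R x) k = c *\<^sub>R Poly_Mapping.lookup x k"
    for c and x :: "'a \<Rightarrow>\<^sub>0 'b" and k
    by (simp add: scaleR_poly_mapping_def map.rep_eq when_def)
  have inner_sum: "inner x y = (\<Sum>k\<in>K. inner (Poly_Mapping.lookup x k) (Poly_Mapping.lookup y k))"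
    if "finite K" "Poly_Mapping.keys x \<subseteq> K" for x y :: "'a \<Rightarrow>\<^sub>0 'b" and K
    unfolding inner_poly_mapping_def using that
    by (intro sum.mono_neutral_left) (auto simp: in_keys_iff)
  fix x y z :: "'a \<Rightarrow>\<^sub>0 'b" and a b r :: real
  let ?K = "Poly_Mapping.keys x \<union> Poly_Mapping.keys y \<union> Poly_Mapping.keys (x + y)
              \<union> Poly_Mapping.keys (r *\<^sub>R x)"
  have K: "finite ?K" by simp
  show "a *\<^sub>R (x + y) = a *\<^sub>R x + a *\<^sub>R y"
    by (rule poly_mapping_eqI) (simp add: look lookup_add scaleR_add_right)
  show "(a + b) *\<^sub>R x = a *\<^sub>R x + b *\<^sub>R x"
    by (rule poly_mapping_eqI) (simp add: look lookup_add scaleR_add_left)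
  show "a *\<^sub>R b *\<^sub>R x = (a * b) *\<^sub>R x"
    by (rule poly_mapping_eqI) (simp add: look)
  show "1 *\<^sub>R x = x"
    by (rule poly_mapping_eqI) (simp add: look)
  show "inner x y = inner y x"
    by (subst (1 2) inner_sum[OF K]) (auto simp: inner_commute)
  show "inner (x + y) z = inner x z + inner y z"
    by (subst (1 2 3) inner_sum[OF K]) (auto simp: lookup_add inner_add_left sum.distrib)
  show "inner (r *\<^sub>R x) y = r * inner x y"
    by (subst (1 2) inner_sum[OF K]) (auto simp: look sum_distrib_left)
  show "0 \<le> inner x x"
    by (simp add: inner_poly_mapping_def sum_nonneg)
  show "inner x x = 0 \<longleftrightarrow> x = 0"
  proof
    assume "inner x x = 0"
    then have "\<forall>k\<in>Poly_Mapping.keys x. Poly_Mapping.lookup x k = 0"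
      by (simp add: inner_poly_mapping_def sum_nonneg_eq_0_iff)
    then show "x = 0"
      by (auto simp: in_keys_iff intro: poly_mapping_eqI)
  qed (simp add: inner_poly_mapping_def)
  show "norm x = sqrt (inner x x)"
    by (rule norm_poly_mapping_def)
  show "sgn x = inverse (norm x) *\<^sub>R x"
    by (rule sgn_poly_mapping_def)
  show "dist x y = norm (x - y)"
    by (rule dist_poly_mapping_def)
qed (rule uniformity_poly_mapping_def open_poly_mapping_def)+

end

definition euclidean_nspace :: "nat \<Rightarrow> (nat \<Rightarrow>\<^sub>0 real) set" where
  "euclidean_nspace d = {x. Poly_Mapping.keys x \<subseteq> {..<d}}"

lemma inner_euclidean_nspace:
  assumes "x \<in> euclidean_nspace d"
  shows "inner x y = (\<Sum>k<d. Poly_Mapping.lookup x k * Poly_Mapping.lookup y k)"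
  unfolding inner_poly_mapping_def inner_real_def
  using assms by (intro sum.mono_neutral_left) (auto simp: euclidean_nspace_def in_keys_iff)

lemma norm_euclidean_nspace:
  assumes "x \<in> euclidean_nspace d"
  shows "norm x = sqrt (\<Sum>k<d. (Poly_Mapping.lookup x k)\<^sup>2)"
  by (simp add: norm_eq_sqrt_inner inner_euclidean_nspace[OF assms] power2_eq_square)

lemma lookup_scaleR:
  "Poly_Mapping.lookup (c *\<^sub>R x) k = c *\<^sub>R Poly_Mapping.lookup x k"
  by (simp add: scaleR_poly_mapping_def map.rep_eq when_def)

lemma euclidean_nspace_coordinates:
  "bij_betw (\<lambda>x. restrict (Poly_Mapping.lookup x) {..<d}) (euclidean_nspace d) ({..<d} \<rightarrow>\<^sub>E UNIV)"
proof (rule bij_betwI')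
  fix x y assume "x \<in> euclidean_nspace d" "y \<in> euclidean_nspace d"
  then show "(restrict (Poly_Mapping.lookup x) {..<d} = restrict (Poly_Mapping.lookup y) {..<d})
    = (x = y)"
    by (auto simp: euclidean_nspace_def in_keys_iff subset_iff fun_eq_iff restrict_def
        intro!: poly_mapping_eqI) metis
next
  fix g :: "nat \<Rightarrow> real" assume g: "g \<in> {..<d} \<rightarrow>\<^sub>E UNIV"
  let ?x = "Abs_poly_mapping (\<lambda>k. if k < d then g k else 0)"
  have "finite {k. (if k < d then g k else 0) \<noteq> 0}"
    by (rule finite_subset[of _ "{..<d}"]) auto
  then have l: "Poly_Mapping.lookup ?x = (\<lambda>k. if k < d then g k else 0)"
    by (rule Abs_poly_mapping_inverse[OF CollectI])
  have "?x \<in> euclidean_nspace d"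
    by (auto simp: euclidean_nspace_def in_keys_iff l split: if_splits)
  moreover have "g = restrict (Poly_Mapping.lookup ?x) {..<d}"
    using g by (auto simp: l fun_eq_iff restrict_def PiE_def extensional_def)
  ultimately show "\<exists>x\<in>euclidean_nspace d. g = restrict (Poly_Mapping.lookup x) {..<d}"
    by blast
qed simp

lemma subspace_euclidean_nspace: "subspace (euclidean_nspace d)"
  by (auto simp: subspace_def euclidean_nspace_def in_keys_iff subset_iff lookup_add lookup_scaleR)
     (metis add.right_neutral)


section \<open>Gradients and strong convexity on a subspace\<close>

text \<open>
  In this and the next section, \<open>X\<close> is the space in which the optimization takes place;
  the values of the functions outside \<open>X\<close> are irrelevant.
\<close>

definition gradient :: "'a::real_inner set \<Rightarrow> ('a \<Rightarrow> real) \<Rightarrow> 'a \<Rightarrow> 'a" where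
  "gradient X f x = (THE g. g \<in> X \<and> (f has_derivative (\<lambda>h. inner g h)) (at x within X))"

definition subdifferential :: "'a::real_inner set \<Rightarrow> ('a \<Rightarrow> real) \<Rightarrow> 'a \<Rightarrow> 'a set" where
  "subdifferential X R x = {\<xi>\<in>X. \<forall>y\<in>X. R y \<ge> R x + inner \<xi> (y - x)}"

text \<open>
  The inequality over all subgradients says nothing at points without subgradients (and nothing
  at all for \<open>\<mu> = 0\<close>), so convexity is a separate requirement.
\<close>

definition strongly_convex :: "'a::real_inner set \<Rightarrow> real \<Rightarrow> ('a \<Rightarrow> real) \<Rightarrow> bool" where
  "strongly_convex X \<mu> R \<longleftrightarrow> convex_on X R \<and>
     (\<forall>x\<in>X. \<forall>y\<in>X. \<forall>\<xi>\<in>subdifferential X R x.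
        R y \<ge> R x + inner \<xi> (y - x) + \<mu> / 2 * (norm (y - x))\<^sup>2)"

definition objective :: "nat \<Rightarrow> (nat \<Rightarrow> 'a \<Rightarrow> real) \<Rightarrow> ('a \<Rightarrow> real) \<Rightarrow> 'a \<Rightarrow> real" where
  "objective n f R x = 1 / real n * (\<Sum>i=1..n. f i x) + R x"

definition L_max :: "nat \<Rightarrow> (nat \<Rightarrow> real) \<Rightarrow> real" where
  "L_max n L = Max (L ` {1..n})"

definition composite_problem ::
  "'a::real_inner set \<Rightarrow> nat \<Rightarrow> (nat \<Rightarrow> 'a \<Rightarrow> real) \<Rightarrow> (nat \<Rightarrow> real) \<Rightarrow> ('a \<Rightarrow> real) \<Rightarrow> real \<Rightarrow> 'a \<Rightarrow> bool"
where
  "composite_problem X n f L R \<mu> x_star \<longleftrightarrow>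
     n \<ge> 1 \<and>
     (\<forall>i\<in>{1..n}. convex_on X (f i) \<and> f i differentiable_on X \<and>
                 (L i)-lipschitz_on X (gradient X (f i))) \<and>
     L_max n L > 0 \<and>
     \<mu> \<ge> 0 \<and> strongly_convex X \<mu> R \<and>
     is_arg_min (objective n f R) (\<lambda>x. x \<in> X) x_star"


section \<open>The SADA algorithm for non-strongly convex regularizers\<close>

text \<open>
  The state of the inner loop after \<open>t\<close> iterations is \<open>(\<phi>\<^sup>t, gbar\<^sub>t, v\<^sub>t, x\<^sub>t, u\<^sub>t)\<close>.  The function
  \<open>sada_update\<close> performs iteration \<open>t\<close> when the index drawn is \<open>i\<close>.
\<close>

type_synonym 'a sada_state = "(nat \<Rightarrow> 'a) \<times> 'a \<times> 'a \<times> 'a \<times> 'a"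

definition sada_update ::
  "'a::real_inner set \<Rightarrow> nat \<Rightarrow> (nat \<Rightarrow> 'a \<Rightarrow> real) \<Rightarrow> ('a \<Rightarrow> real) \<Rightarrow> real \<Rightarrow> 'a \<Rightarrow> nat \<Rightarrow> nat
    \<Rightarrow> 'a sada_state \<Rightarrow> 'a sada_state"
where
  "sada_update X n f R \<eta> v0 t i = (\<lambda>(\<phi>, gbar, v, x, u).
     let
       \<phi>' = \<phi>(i := u);
       g = gradient X (f i) (\<phi>' i) - gradient X (f i) (\<phi> i)
             + (1 / real n) *\<^sub>R (\<Sum>j=1..n. gradient X (f j) (\<phi> j));
       gbar' = (1 - 1 / real t) *\<^sub>R gbar + (1 / real t) *\<^sub>R g;
       v' = arg_min (\<lambda>y. inner gbar' y + R y + \<eta> / (2 * real t) * (norm (y - v0))\<^sup>2) (\<lambda>y. y \<in> X);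
       x' = arg_min (\<lambda>y. inner g y + R y + \<eta> * real t / 2 * (norm (y - u))\<^sup>2) (\<lambda>y. y \<in> X);
       u' = (1 - 1 / real (t + 1)) *\<^sub>R x' + (1 / real (t + 1)) *\<^sub>R v'
     in (\<phi>', gbar', v', x', u'))"

primrec sada_inner ::
  "'a::real_inner set \<Rightarrow> nat \<Rightarrow> (nat \<Rightarrow> 'a \<Rightarrow> real) \<Rightarrow> ('a \<Rightarrow> real) \<Rightarrow> real \<Rightarrow> 'a \<Rightarrow> 'a \<Rightarrow> nat
    \<Rightarrow> 'a sada_state pmf"
where
  "sada_inner X n f R \<eta> x0 v0 0 = return_pmf (\<lambda>i. x0, 0, v0, x0, v0)"
| "sada_inner X n f R \<eta> x0 v0 (Suc t) =
     bind_pmf (sada_inner X n f R \<eta> x0 v0 t) (\<lambda>state.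
     bind_pmf (pmf_of_set {1..n}) (\<lambda>i.
     return_pmf (sada_update X n f R \<eta> v0 (Suc t) i state)))"

definition stage_length :: "nat \<Rightarrow> nat \<Rightarrow> nat" where
  "stage_length m1 s = 2 ^ (s - 1) * m1"

text \<open>
  The joint law of the outputs \<open>x\<close> and \<open>v\<close> (in this order) of the first \<open>s\<close> stages.
\<close>

primrec sada ::
  "'a::real_inner set \<Rightarrow> nat \<Rightarrow> (nat \<Rightarrow> 'a \<Rightarrow> real) \<Rightarrow> ('a \<Rightarrow> real) \<Rightarrow> real \<Rightarrow> nat \<Rightarrow> real \<Rightarrow> 'a \<Rightarrow> nat
    \<Rightarrow> ('a \<times> 'a) pmf"
where
  "sada X n f R \<eta> m1 \<alpha> x_init 0 = return_pmf (x_init, x_init)"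
| "sada X n f R \<eta> m1 \<alpha> x_init (Suc s) =
     bind_pmf (sada X n f R \<eta> m1 \<alpha> x_init s) (\<lambda>(x0, v_prev).
       let v0 = (1 - \<alpha>) *\<^sub>R v_prev + \<alpha> *\<^sub>R x0 in
       map_pmf (\<lambda>(\<phi>, gbar, v, x, u). (x, v))
         (sada_inner X n f R \<eta> x0 v0 (stage_length m1 (Suc s))))"

definition expected_gap ::
  "'a::real_inner set \<Rightarrow> nat \<Rightarrow> (nat \<Rightarrow> 'a \<Rightarrow> real) \<Rightarrow> ('a \<Rightarrow> real) \<Rightarrow> real \<Rightarrow> nat \<Rightarrow> real \<Rightarrow> 'a \<Rightarrow> 'a
    \<Rightarrow> nat \<Rightarrow> real"
where
  "expected_gap X n f R \<eta> m1 \<alpha> x_init x_star S =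
     measure_pmf.expectation (sada X n f R \<eta> m1 \<alpha> x_init S)
       (\<lambda>(x, v). objective n f R x - objective n f R x_star)"

text \<open>
  A stage starts with a full gradient and then needs two component gradients per iteration,
  because the average of the stored gradients is updated incrementally.
\<close>

definition gradient_evaluations :: "nat \<Rightarrow> nat \<Rightarrow> nat \<Rightarrow> nat" where
  "gradient_evaluations n m1 S = (\<Sum>s=1..S. n + 2 * stage_length m1 s)"

end

theory Submission
  imports Defs
begin

text \<open>
  Write \<open>L\<close> for the largest Lipschitz constant, so that \<open>\<eta> = 5L\<close>, and let
  \<open>\<psi>\<^sub>t(y) = \<langle>g\<^sub>1 + \<dots> + g\<^sub>t, y\<rangle> + t R(y) + \<eta>/2 \<parallel>y - v\<^sub>0\<parallel>\<^sup>2\<close>, of which \<open>v\<^sub>t\<close> is the minimizer.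
  Within one stage, the quantity
  \<open>V\<^sub>t = t (P(x\<^sub>t) - P(x\<^sub>*)) - (\<psi>\<^sub>t(v\<^sub>t) - \<psi>\<^sub>t(x\<^sub>*)) + n/(4L) B\<^sub>t\<close>, where \<open>B\<^sub>t\<close> is the average of
  \<open>\<parallel>\<nabla>f\<^sub>i(\<phi>\<^sub>i\<^sup>t) - \<nabla>f\<^sub>i(x\<^sub>*)\<parallel>\<^sup>2\<close>, does not increase in expectation.

  The reason is the coupling \<open>u\<^sub>t\<^sub>-\<^sub>1 = ((t-1) x\<^sub>t\<^sub>-\<^sub>1 + v\<^sub>t\<^sub>-\<^sub>1)/t\<close>.  Comparing \<open>x\<^sub>t\<close> with the point
  \<open>((t-1) x\<^sub>t\<^sub>-\<^sub>1 + v\<^sub>t)/t\<close>, which is \<open>u\<^sub>t\<^sub>-\<^sub>1 + (v\<^sub>t - v\<^sub>t\<^sub>-\<^sub>1)/t\<close>, costs \<open>\<eta>/2 \<parallel>v\<^sub>t - v\<^sub>t\<^sub>-\<^sub>1\<parallel>\<^sup>2\<close>, and strong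
  convexity of \<open>\<psi>\<^sub>t\<^sub>-\<^sub>1\<close> pays exactly that.  What is left of the proximal penalty of \<open>x\<^sub>t\<close> after the
  smoothness term bounds the effect of the gradient noise by \<open>1/(8L)\<close> times its square
  (\<open>one_step_descent\<close>).  In expectation the square is at most \<open>2 D + 2 B\<^sub>t\<^sub>-\<^sub>1\<close>, where \<open>D\<close> is the average of
  \<open>\<parallel>\<nabla>f\<^sub>i(u\<^sub>t\<^sub>-\<^sub>1) - \<nabla>f\<^sub>i(x\<^sub>*)\<parallel>\<^sup>2\<close>; refreshing one table entry changes \<open>n B\<close> by \<open>D - B\<^sub>t\<^sub>-\<^sub>1\<close> in
  expectation; and co-coercivity at \<open>x\<^sub>*\<close> provides \<open>- D/(2L)\<close>.  The total is
  \<open>(2 D + 2 B)/(8L) + (D - B)/(4L) - D/(2L) = 0\<close> (\<open>expected_potential_decreases\<close>).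

  Since a table entry survives an iteration with probability \<open>1 - 1/n\<close>, the expectation of \<open>B\<^sub>m\<close> is at least
  \<open>(1 - 1/n)\<^sup>m B\<^sub>0 \<ge> (1 - m/n) B\<^sub>0\<close>, so that the table terms contribute at most
  \<open>m/(4L) B\<^sub>0 \<le> m/2 (P(x\<^sub>0) - P(x\<^sub>*))\<close>, independently of \<open>n\<close>.  Dividing by \<open>m\<close>, a stage maps
  \<open>P(x) - P(x\<^sub>*) + \<eta>/m \<parallel>v - x\<^sub>*\<parallel>\<^sup>2\<close> to at most half its value, with \<open>2m\<close> in place of \<open>m\<close>
  (\<open>stage_halves_potential\<close>).  As the stage lengths double, the stages compose.  For accuracy
  \<open>\<epsilon>\<close>, about \<open>log\<^sub>2(K/\<epsilon>)\<close> stages suffice, where \<open>K\<close> is \<open>1\<close> plus the initial value of this quantity; their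
  total length is of order \<open>m\<^sub>1 K/\<epsilon>\<close>.

  Finite dimension enters only through three facts: the space is complete, convex functions on it are continuous
  (so that the proximal problems have solutions) and linear forms on it are represented by
  gradients.  Everything else holds in a complete subspace of any inner product space.
\<close>

section \<open>Finite-dimensional Euclidean space\<close>

definition unit_vector :: "nat \<Rightarrow> nat \<Rightarrow>\<^sub>0 real" where
  "unit_vector k = Poly_Mapping.single k 1"

text \<open>The orthogonal projection onto \<open>euclidean_nspace d\<close>.\<close>

definition truncate :: "nat \<Rightarrow> (nat \<Rightarrow>\<^sub>0 real) \<Rightarrow> (nat \<Rightarrow>\<^sub>0 real)" where
  "truncate d x = (\<Sum>k<d. Poly_Mapping.lookup x k *\<^sub>R unit_vector k)"

lemma unit_vector_in: "k < d \<Longrightarrow> unit_vector k \<in> euclidean_nspace d"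
  by (simp add: unit_vector_def euclidean_nspace_def)

lemma inner_unit_vector: "inner (unit_vector k) x = Poly_Mapping.lookup x k"
  by (simp add: unit_vector_def inner_poly_mapping_def)

lemma lookup_truncate:
  "Poly_Mapping.lookup (truncate d x) k = (if k < d then Poly_Mapping.lookup x k else 0)"
proof -
  have "Poly_Mapping.lookup (truncate d x) k
      = (\<Sum>j<d. Poly_Mapping.lookup x j * Poly_Mapping.lookup (unit_vector j) k)"
    by (simp add: truncate_def lookup_sum lookup_scaleR)
  also have "\<dots> = (\<Sum>j<d. if j = k then Poly_Mapping.lookup x k else 0)"
    by (intro sum.cong) (auto simp: unit_vector_def lookup_single)
  finally show ?thesis by simp
qed

lemma truncate_in: "truncate d x \<in> euclidean_nspace d"
  by (auto simp: euclidean_nspace_def in_keys_iff lookup_truncate split: if_splits)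

lemma truncate_eq: "x \<in> euclidean_nspace d \<Longrightarrow> truncate d x = x"
  by (rule poly_mapping_eqI) (auto simp: lookup_truncate euclidean_nspace_def in_keys_iff subset_iff)

lemma truncate_add: "truncate d (x + y) = truncate d x + truncate d y"
  by (rule poly_mapping_eqI) (simp add: lookup_truncate lookup_add)

lemma truncate_scaleR: "truncate d (c *\<^sub>R x) = c *\<^sub>R truncate d x"
  by (rule poly_mapping_eqI) (simp add: lookup_truncate lookup_scaleR)

lemma abs_lookup_le_norm: "\<bar>Poly_Mapping.lookup x k\<bar> \<le> norm (x :: nat \<Rightarrow>\<^sub>0 real)"
proof -
  have "norm (unit_vector k) = 1"
    by (simp add: norm_eq_sqrt_inner inner_unit_vector) (simp add: unit_vector_def)
  then show ?thesis
    using Cauchy_Schwarz_ineq2[of "unit_vector k" x] by (simp add: inner_unit_vector)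
qed

text \<open>Coordinates of a Cauchy sequence converge, and a point is a fixed finite combination of its
  coordinates.\<close>

lemma complete_euclidean_nspace: "complete (euclidean_nspace d)"
  unfolding complete_def
proof (intro allI impI, elim conjE)
  fix y assume y: "\<forall>k. y k \<in> euclidean_nspace d" and C: "Cauchy y"
  have "Cauchy (\<lambda>j. Poly_Mapping.lookup (y j) k)" for k
    unfolding Cauchy_def
  proof (intro allI impI)
    fix e :: real assume "e > 0"
    then obtain M where M: "\<forall>i\<ge>M. \<forall>j\<ge>M. dist (y i) (y j) < e" using C unfolding Cauchy_def by blast
    have "dist (Poly_Mapping.lookup (y i) k) (Poly_Mapping.lookup (y j) k) \<le> dist (y i) (y j)" for i j
      using abs_lookup_le_norm[of "y i - y j" k] by (simp add: dist_norm lookup_minus)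
    then show "\<exists>M. \<forall>i\<ge>M. \<forall>j\<ge>M. dist (Poly_Mapping.lookup (y i) k) (Poly_Mapping.lookup (y j) k) < e"
      using M by (meson le_less_trans)
  qed
  then have "\<forall>k. \<exists>l. (\<lambda>j. Poly_Mapping.lookup (y j) k) \<longlonglongrightarrow> l"
    using real_Cauchy_convergent convergent_def by blast
  then obtain l where l: "\<And>k. (\<lambda>j. Poly_Mapping.lookup (y j) k) \<longlonglongrightarrow> l k" by metis
  let ?v = "\<Sum>k<d. l k *\<^sub>R unit_vector k"
  have "(\<lambda>j. truncate d (y j)) \<longlonglongrightarrow> ?v"
    unfolding truncate_def by (intro tendsto_intros l)
  then have "y \<longlonglongrightarrow> ?v" using y by (simp add: truncate_eq)
  moreover have "?v \<in> euclidean_nspace d"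
    by (intro subspace_sum subspace_scale subspace_euclidean_nspace unit_vector_in) auto
  ultimately show "\<exists>l\<in>euclidean_nspace d. y \<longlonglongrightarrow> l" by blast
qed

text \<open>Every point of a small ball is an average of points on the coordinate segments
  \<open>[x - e\<^sub>k, x + e\<^sub>k]\<close>, so a convex function is bounded on that ball.\<close>

lemma convex_on_euclidean_nspace_locally_bounded:
  assumes R: "convex_on (euclidean_nspace d) R" and x: "x \<in> euclidean_nspace d"
  shows "\<exists>\<delta>>0. \<exists>M. \<forall>y\<in>euclidean_nspace d. norm (y - x) \<le> \<delta> \<longrightarrow> \<bar>R y\<bar> \<le> M"
proof (cases "d = 0")
  case True
  then have "\<forall>y\<in>euclidean_nspace d. y = 0" by (simp add: euclidean_nspace_def)
  then have "\<forall>y\<in>euclidean_nspace d. norm (y - x) \<le> 1 \<longrightarrow> \<bar>R y\<bar> \<le> \<bar>R 0\<bar>"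
    by (metis order_refl)
  then show ?thesis using zero_less_one by blast
next
  case False
  let ?X = "euclidean_nspace d"
  note sub = subspace_euclidean_nspace[of d]
  define M where "M = (\<Sum>k<d. \<bar>R (x + unit_vector k)\<bar> + \<bar>R (x - unit_vector k)\<bar>)"
  have mem: "x + c *\<^sub>R unit_vector k \<in> ?X" if "k < d" for c k
    using sub x that by (intro subspace_add subspace_scale unit_vector_in)
  have coord: "R (x + c *\<^sub>R unit_vector k) \<le> M" if k: "k < d" and c: "\<bar>c\<bar> \<le> 1" for c k
  proof -
    have "x + c *\<^sub>R unit_vector k = ((1 + c) / 2) *\<^sub>R (x + unit_vector k) + ((1 - c) / 2) *\<^sub>R (x - unit_vector k)"
      by (rule poly_mapping_eqI) (simp add: lookup_add lookup_minus lookup_scaleR field_simps)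
    also have "R \<dots> \<le> (1 + c) / 2 * R (x + unit_vector k) + (1 - c) / 2 * R (x - unit_vector k)"
      using convex_onD[OF R, of "(1 - c) / 2" "x + unit_vector k" "x - unit_vector k"]
        c mem[OF k, of 1] mem[OF k, of "-1"] by (simp add: diff_divide_distrib add_divide_distrib)
    also have "\<dots> \<le> 1 * \<bar>R (x + unit_vector k)\<bar> + 1 * \<bar>R (x - unit_vector k)\<bar>"
    proof -
      have "a * b \<le> 1 * \<bar>b\<bar>" if "0 \<le> a" "a \<le> 1" for a b :: real
        using that by (meson abs_ge_self abs_ge_zero mult_left_mono mult_right_mono order_trans)
      from this[of "(1 + c) / 2"] this[of "(1 - c) / 2"] show ?thesis
        using c by (intro add_mono) (auto simp: abs_le_iff)
    qed
    also have "\<dots> \<le> M"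
      unfolding M_def using k
      by (subst sum.remove[of _ k]) (auto intro!: sum_nonneg)
    finally show ?thesis .
  qed
  have upper: "R y \<le> M" if y: "y \<in> ?X" and yx: "norm (y - x) \<le> 1 / d" for y
  proof -
    let ?c = "\<lambda>k. real d * Poly_Mapping.lookup (y - x) k"
    have c: "\<bar>?c k\<bar> \<le> 1" for k
      using order_trans[OF abs_lookup_le_norm[of "y - x" k] yx] False
      by (simp add: abs_mult field_simps)
    have "y = x + truncate d (y - x)"
      using truncate_eq[OF subspace_diff[OF sub y x]] by simp
    also have "\<dots> = (\<Sum>k<d. (1 / d) *\<^sub>R (x + ?c k *\<^sub>R unit_vector k))"
      using False by (simp add: truncate_def scaleR_add_right sum.distrib scaleR_right.sum[symmetric]
          sum_constant_scaleR del: sum_constant)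
    also have "R \<dots> \<le> (\<Sum>k<d. (1 / d) * R (x + ?c k *\<^sub>R unit_vector k))"
      using False R mem by (intro convex_on_sum[where C = ?X]) auto
    also have "\<dots> \<le> (\<Sum>k<d. (1 / d) * M)"
      using c coord by (intro sum_mono mult_left_mono) auto
    also have "\<dots> = M" using False by simp
    finally show ?thesis .
  qed
  have "\<bar>R y\<bar> \<le> M + 2 * \<bar>R x\<bar>" if y: "y \<in> ?X" and yx: "norm (y - x) \<le> 1 / d" for y
  proof -
    \<comment> \<open>reflecting \<open>y\<close> in \<open>x\<close> turns the upper bound into a lower bound\<close>
    let ?y' = "x - (y - x)"
    have y': "?y' \<in> ?X" by (intro subspace_diff sub x y)
    have "x = (1 / 2) *\<^sub>R y + (1 / 2) *\<^sub>R ?y'"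
      by (rule poly_mapping_eqI) (simp only: lookup_add lookup_minus lookup_scaleR, simp add: field_simps)
    also have "R \<dots> \<le> 1 / 2 * R y + 1 / 2 * R ?y'"
      using convex_onD[OF R, of "1 / 2" y ?y'] y y' by simp
    also have "R ?y' \<le> M"
      using y' yx by (intro upper) (simp_all add: norm_minus_commute)
    finally show ?thesis using upper[OF y yx] by linarith
  qed
  then show ?thesis using False by (intro exI[of _ "1 / real d"]) auto
qed

text \<open>A convex function is continuous wherever it is bounded on a neighbourhood.\<close>

lemma convex_on_euclidean_nspace_continuous:
  assumes R: "convex_on (euclidean_nspace d) R"
  shows "continuous_on (euclidean_nspace d) R"
  unfolding continuous_on_eq_continuous_within
proof
  let ?X = "euclidean_nspace d"
  fix x assume x: "x \<in> ?X"
  \<comment> \<open>\<open>?X\<close> is not open in the ambient space, so \<open>R\<close> is first extended to all of it\<close>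
  define R' where "R' y = R (truncate d y)" for y
  have conv: "convex_on UNIV R'"
    using R truncate_in unfolding convex_on_def R'_def by (auto simp: truncate_add truncate_scaleR)
  obtain \<delta> M where \<delta>: "\<delta> > 0" and M: "\<And>y. y \<in> ?X \<Longrightarrow> norm (y - x) \<le> \<delta> \<Longrightarrow> \<bar>R y\<bar> \<le> M"
    using convex_on_euclidean_nspace_locally_bounded[OF R x] by blast
  have contr: "norm (truncate d y) \<le> norm y" for y
  proof -
    have "(norm (truncate d y))\<^sup>2 = inner (truncate d y) y"
      by (simp add: power2_norm_eq_inner inner_euclidean_nspace[OF truncate_in] lookup_truncate)
    also have "\<dots> \<le> norm (truncate d y) * norm y" by (rule norm_cauchy_schwarz)
    finally show ?thesis
      by (metis mult_le_cancel_left_pos norm_ge_zero order_le_less power2_eq_square)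
  qed
  have "norm (truncate d y - x) \<le> norm (y - x)" for y
    using contr[of "y - x"] truncate_add[of d y "-1 *\<^sub>R x"]
    by (simp add: truncate_scaleR[of d "-1", simplified] truncate_eq[OF x])
  then have "\<forall>y\<in>ball x \<delta>. \<bar>R' y\<bar> \<le> M"
    unfolding R'_def by (auto intro!: M truncate_in simp: dist_norm norm_minus_commute[of x])
       (meson less_imp_le order_trans)
  then have "continuous_on (ball x \<delta>) R'"
    using conv by (intro convex_on_bounded_continuous convex_on_subset[OF conv]) auto
  then have "continuous (at x within ?X) R'"
    using \<delta> by (simp add: continuous_on_eq_continuous_at continuous_at_imp_continuous_at_within)
  then show "continuous (at x within ?X) R"
    by (rule continuous_transform_within[where \<delta> = 1])
       (auto simp: R'_def truncate_eq x)
qed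

text \<open>The coordinates of the gradient are the partial derivatives; directional derivatives within
  the subspace determine it, which makes the description in \<^const>\<open>gradient\<close> definite.\<close>

lemma gradient_euclidean_nspace:
  assumes "f differentiable (at x within euclidean_nspace d)" and x: "x \<in> euclidean_nspace d"
  shows "gradient (euclidean_nspace d) f x \<in> euclidean_nspace d"
    and "(f has_derivative (\<lambda>h. inner (gradient (euclidean_nspace d) f x) h)) (at x within euclidean_nspace d)"
proof -
  let ?X = "euclidean_nspace d"
  let ?P = "\<lambda>g. g \<in> ?X \<and> (f has_derivative (\<lambda>h. inner g h)) (at x within ?X)"
  note sub = subspace_euclidean_nspace[of d]
  obtain f' where f': "(f has_derivative f') (at x within ?X)"
    using assms(1) unfolding differentiable_def by blast
  then interpret bounded_linear f' by (rule has_derivative_bounded_linear)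
  define g where "g = (\<Sum>k<d. f' (unit_vector k) *\<^sub>R unit_vector k)"
  have g: "g \<in> ?X"
    unfolding g_def by (intro subspace_sum subspace_scale sub unit_vector_in) auto
  have "f' h = inner g h" if "h \<in> ?X" for h
  proof -
    have "f' h = f' (truncate d h)" using that by (simp add: truncate_eq)
    also have "\<dots> = inner g h"
      by (simp add: truncate_def g_def sum scaleR inner_sum_left inner_unit_vector mult.commute)
    finally show ?thesis .
  qed
  then have "?P g"
    using f' g subspace_diff[OF sub _ x] unfolding has_derivative_within
    by (auto simp: bounded_linear_inner_right cong: Lim_cong_within)
  moreover have "g1 = g2" if "?P g1" "?P g2" for g1 g2
  proof -
    let ?w = "g1 - g2"
    have w: "?w \<in> ?X" using that sub by (auto intro: subspace_diff)
    \<comment> \<open>both are the derivative along the line through \<open>x\<close> in direction \<open>g1 - g2\<close>\<close>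
    have "((\<lambda>t. f (x + t *\<^sub>R ?w)) has_real_derivative inner g ?w) (at 0)" if "?P g" for g
    proof -
      have "((\<lambda>t. x + t *\<^sub>R ?w) has_derivative (\<lambda>h. h *\<^sub>R ?w)) (at 0)"
        by (auto intro!: derivative_eq_intros)
      moreover have "(f has_derivative (\<lambda>h. inner g h)) (at (x + 0 *\<^sub>R ?w) within range (\<lambda>t. x + t *\<^sub>R ?w))"
        using that sub w x by (auto intro!: has_derivative_subset[where s = ?X] subspace_add subspace_scale)
      ultimately have "((\<lambda>t. f (x + t *\<^sub>R ?w)) has_derivative (\<lambda>h. inner g (h *\<^sub>R ?w))) (at 0)"
        by (rule has_derivative_in_compose)
      then show ?thesis by (simp add: has_field_derivative_def mult_commute_abs)
    qed
    then have "inner g1 ?w = inner g2 ?w" using that DERIV_unique by blast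
    then have "inner ?w ?w = 0" by (simp add: inner_diff_left)
    then show "g1 = g2" by simp
  qed
  ultimately have "\<exists>!g. ?P g" by blast
  then have "?P (gradient ?X f x)"
    unfolding gradient_def by (rule theI')
  then show "gradient ?X f x \<in> ?X"
    "(f has_derivative (\<lambda>h. inner (gradient ?X f x) h)) (at x within ?X)" by blast+
qed

section \<open>Smooth convex functions on a subspace\<close>

locale smooth_convex =
  fixes X :: "'a::real_inner set" and f :: "'a \<Rightarrow> real" and grad :: "'a \<Rightarrow> 'a" and L :: real
  assumes subspace: "subspace X"
    and convex_f: "convex_on X f"
    and deriv: "x \<in> X \<Longrightarrow> (f has_derivative (\<lambda>h. inner (grad x) h)) (at x within X)"
    and grad_in: "x \<in> X \<Longrightarrow> grad x \<in> X"
    and lipschitz: "x \<in> X \<Longrightarrow> y \<in> X \<Longrightarrow> norm (grad x - grad y) \<le> L * norm (x - y)"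
    and L_pos: "L > 0"
begin

lemma segment_in: "x \<in> X \<Longrightarrow> y \<in> X \<Longrightarrow> x + t *\<^sub>R (y - x) \<in> X"
  using subspace by (intro subspace_add subspace_scale subspace_diff)

text \<open>The tangent and parabola bounds below reduce to one real variable by restricting \<open>f\<close> to the line through
  \<open>x\<close> and \<open>y\<close>.\<close>

lemma deriv_along_segment:
  assumes "x \<in> X" "y \<in> X"
  shows "((\<lambda>t. f (x + t *\<^sub>R (y - x))) has_real_derivative inner (grad (x + t *\<^sub>R (y - x))) (y - x)) (at t)"
proof -
  have "((\<lambda>t. x + t *\<^sub>R (y - x)) has_derivative (\<lambda>h. h *\<^sub>R (y - x))) (at t)"
    by (auto intro!: derivative_eq_intros)
  then have "((\<lambda>t. f (x + t *\<^sub>R (y - x))) has_derivative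
      (\<lambda>h. inner (grad (x + t *\<^sub>R (y - x))) (h *\<^sub>R (y - x)))) (at t within UNIV)"
    using segment_in[OF assms]
    by (intro has_derivative_in_compose2[of X f "\<lambda>z h. inner (grad z) h" "\<lambda>t. x + t *\<^sub>R (y - x)" UNIV])
       (auto intro: deriv)
  then show ?thesis
    by (simp add: has_field_derivative_def mult_commute_abs)
qed

lemma above_tangent:
  assumes "x \<in> X" "y \<in> X"
  shows "f y \<ge> f x + inner (grad x) (y - x)"
proof -
  have "convex_on UNIV (\<lambda>t. f (x + t *\<^sub>R (y - x)))"
    unfolding convex_on_def
  proof (intro conjI ballI allI impI)
    fix s t u v :: real assume uv: "0 \<le> u" "0 \<le> v" "u + v = 1"
    have "x + (u *\<^sub>R s + v *\<^sub>R t) *\<^sub>R (y - x)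
        = (u + v) *\<^sub>R x + (u * s + v * t) *\<^sub>R (y - x)"
      by (simp add: uv)
    also have "\<dots> = u *\<^sub>R (x + s *\<^sub>R (y - x)) + v *\<^sub>R (x + t *\<^sub>R (y - x))"
      by (simp add: algebra_simps del: uv)
    finally show "f (x + (u *\<^sub>R s + v *\<^sub>R t) *\<^sub>R (y - x))
        \<le> u * f (x + s *\<^sub>R (y - x)) + v * f (x + t *\<^sub>R (y - x))"
      using convex_f uv segment_in[OF assms] unfolding convex_on_def by metis
  qed simp
  from convex_on_imp_above_tangent[OF this, of 0 1 "inner (grad x) (y - x)"]
  show ?thesis using deriv_along_segment[OF assms, of 0] by simp
qed

lemma below_parabola:
  assumes "x \<in> X" "y \<in> X"
  shows "f y \<le> f x + inner (grad x) (y - x) + L / 2 * (norm (y - x))\<^sup>2"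
proof -
  define h where "h t = f (x + t *\<^sub>R (y - x)) - t * inner (grad x) (y - x)
    - L / 2 * t\<^sup>2 * (norm (y - x))\<^sup>2" for t
  have "h 1 \<le> h 0"
  proof (rule DERIV_nonpos_imp_nonincreasing[where f = h])
    fix t :: real assume t: "0 \<le> t" "t \<le> 1"
    let ?z = "x + t *\<^sub>R (y - x)"
    have "(h has_real_derivative
        inner (grad ?z) (y - x) - inner (grad x) (y - x) - L * t * (norm (y - x))\<^sup>2) (at t)"
      unfolding h_def
      by (auto intro!: derivative_eq_intros deriv_along_segment[OF assms])
    moreover have "inner (grad ?z - grad x) (y - x) \<le> norm (grad ?z - grad x) * norm (y - x)"
      by (rule norm_cauchy_schwarz)
    moreover have "\<dots> \<le> (L * norm (?z - x)) * norm (y - x)"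
      by (intro mult_right_mono lipschitz segment_in assms) simp
    ultimately show "\<exists>y. (h has_real_derivative y) (at t) \<and> y \<le> 0"
      using t by (intro exI conjI) (auto simp: inner_diff_left power2_eq_square)
  qed simp
  then show ?thesis by (simp add: h_def)
qed

text \<open>Co-coercivity: \<open>f - \<langle>\<nabla>f(x), \<cdot>\<rangle>\<close> is minimal at \<open>x\<close>, so a gradient step from \<open>y\<close> cannot
  get below its value at \<open>x\<close>.\<close>

lemma cocoercive:
  assumes "x \<in> X" "y \<in> X"
  shows "f y \<ge> f x + inner (grad x) (y - x) + 1 / (2 * L) * (norm (grad y - grad x))\<^sup>2"
proof -
  define w where "w = grad y - grad x"
  define z where "z = y - (1 / L) *\<^sub>R w"
  have z: "z \<in> X"
    unfolding z_def w_def using subspace assms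
    by (intro subspace_diff subspace_scale grad_in)
  have zy: "z - y = - ((1 / L) *\<^sub>R w)" by (simp add: z_def)
  have n: "(norm (z - y))\<^sup>2 = (norm w)\<^sup>2 / L\<^sup>2"
    using L_pos by (simp add: zy power_divide)
  have i: "inner (grad y) (z - y) - inner (grad x) (z - y) = - (norm w)\<^sup>2 / L"
    by (simp add: zy power2_norm_eq_inner)
       (simp add: w_def inner_diff_left diff_divide_distrib)
  have "inner (grad x) (z - x) = inner (grad x) (z - y) + inner (grad x) (y - x)"
    by (simp add: inner_diff_right)
  moreover have "L / 2 * ((norm w)\<^sup>2 / L\<^sup>2) = (norm w)\<^sup>2 / (2 * L)"
    using L_pos by (simp add: power2_eq_square)
  moreover have "(norm w)\<^sup>2 / L = 2 * ((norm w)\<^sup>2 / (2 * L))" by simp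
  ultimately show ?thesis
    using above_tangent[OF assms(1) z] below_parabola[OF assms(2) z] i
    unfolding n w_def[symmetric] by simp
qed

end

section \<open>Proximal steps\<close>

text \<open>Comparing \<open>v\<close> with the points \<open>v + t (y - v)\<close> gives the claim with the factor \<open>1 - t\<close> in front of
  \<open>\<parallel>y - v\<parallel>\<^sup>2\<close>, and then \<open>t\<close> tends to \<open>0\<close>.\<close>

lemma quadratic_growth_at_minimizer:
  fixes X :: "'a::real_inner set"
  assumes G: "convex_on X G" and v: "v \<in> X" and y: "y \<in> X"
    and min: "\<And>z. z \<in> X \<Longrightarrow> G v + c / 2 * (norm (v - a))\<^sup>2 \<le> G z + c / 2 * (norm (z - a))\<^sup>2"
  shows "G v + c / 2 * (norm (v - a))\<^sup>2 + c / 2 * (norm (y - v))\<^sup>2 \<le> G y + c / 2 * (norm (y - a))\<^sup>2"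
proof -
  define A where "A = G y + c / 2 * (norm (y - a))\<^sup>2 - (G v + c / 2 * (norm (v - a))\<^sup>2)"
  have "c / 2 * (norm (y - v))\<^sup>2 * (1 - t) \<le> A" if t: "0 < t" "t < 1" for t
  proof -
    let ?z = "(1 - t) *\<^sub>R v + t *\<^sub>R y"
    have z: "?z \<in> X" "G ?z \<le> (1 - t) * G v + t * G y"
      using G v y t unfolding convex_on_def convex_def by auto
    have za: "?z - a = (1 - t) *\<^sub>R (v - a) + t *\<^sub>R (y - a)" by (simp add: algebra_simps)
    have yv: "y - v = (y - a) - (v - a)" by simp
    have "(norm (?z - a))\<^sup>2 = (1 - t) * (norm (v - a))\<^sup>2 + t * (norm (y - a))\<^sup>2
        - t * (1 - t) * (norm (y - v))\<^sup>2"
      unfolding za yv power2_norm_eq_inner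
      by (simp add: inner_add inner_diff inner_commute[of "y - a" "v - a"] del: add_diff_cancel diff_diff_eq2 diff_add_cancel)
         (simp add: algebra_simps inner_commute)
    then have "G v + c / 2 * (norm (v - a))\<^sup>2 \<le> (1 - t) * G v + t * G y
       + c / 2 * ((1 - t) * (norm (v - a))\<^sup>2 + t * (norm (y - a))\<^sup>2 - t * (1 - t) * (norm (y - v))\<^sup>2)"
      using min[OF z(1)] z(2) by simp
    then have "t * (c / 2 * (norm (y - v))\<^sup>2 * (1 - t)) \<le> t * A"
      unfolding A_def by (simp add: algebra_simps add_divide_distrib diff_divide_distrib)
    then show ?thesis using t by simp
  qed
  then have "\<forall>\<^sub>F t in at_right 0. c / 2 * (norm (y - v))\<^sup>2 * (1 - t) \<le> A"
    by (auto simp: eventually_at_right_field intro!: exI[of _ 1])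
  moreover have "((\<lambda>t::real. c / 2 * (norm (y - v))\<^sup>2 * (1 - t)) \<longlongrightarrow> c / 2 * (norm (y - v))\<^sup>2 * (1 - 0)) (at_right 0)"
    by (intro tendsto_intros)
  ultimately have "c / 2 * (norm (y - v))\<^sup>2 * (1 - 0) \<le> A"
    by (intro tendsto_upperbound) auto
  then show ?thesis by (simp add: A_def)
qed

text \<open>An affine minorant of \<open>G\<close> bounds the objective below; a minimizing sequence is Cauchy by
  strong convexity, so completeness replaces compactness.\<close>

lemma prox_exists:
  fixes X :: "'a::real_inner set"
  assumes X: "complete X" "X \<noteq> {}" and G: "convex_on X G" "continuous_on X G" and c: "c > 0"
    and below: "\<And>y. y \<in> X \<Longrightarrow> G y \<ge> b + inner \<xi> y"
  shows "\<exists>v. is_arg_min (\<lambda>y. G y + c / 2 * (norm (y - a))\<^sup>2) (\<lambda>y. y \<in> X) v"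
proof -
  define H where "H y = G y + c / 2 * (norm (y - a))\<^sup>2" for y
  define I where "I = (INF y\<in>X. H y)"
  \<comment> \<open>completing the square: a linear form plus a quadratic is bounded below\<close>
  have sq: "inner \<xi> w + c / 2 * (norm w)\<^sup>2 \<ge> - (norm \<xi>)\<^sup>2 / (2 * c)" for w
  proof -
    have "0 \<le> c / 2 * (norm (w + (1 / c) *\<^sub>R \<xi>))\<^sup>2" using c by simp
    also have "\<dots> = inner \<xi> w + c / 2 * (norm w)\<^sup>2 + (norm \<xi>)\<^sup>2 / (2 * c)"
      using c unfolding power2_norm_eq_inner
      by (simp add: inner_add inner_commute field_simps power2_eq_square)
    finally show ?thesis by simp
  qed
  have bdd: "bdd_below (H ` X)"
  proof (rule bdd_belowI2)
    fix y assume "y \<in> X"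
    then show "b + inner \<xi> a - (norm \<xi>)\<^sup>2 / (2 * c) \<le> H y"
      using below[of y] sq[of "y - a"] by (simp add: H_def inner_diff_right)
  qed
  have I_le: "I \<le> H y" if "y \<in> X" for y
    unfolding I_def using bdd that by (rule cINF_lower)
  have "\<exists>y\<in>X. H y < I + 1 / Suc k" for k
    using X(2) unfolding I_def by (subst cINF_less_iff[OF _ bdd, symmetric]) auto
  then obtain y where y: "\<And>k. y k \<in> X" "\<And>k. H (y k) < I + 1 / Suc k" by metis
  \<comment> \<open>the parallelogram law bounds the distance of near-minimizers\<close>
  have dist: "c / 4 * (norm (p - q))\<^sup>2 \<le> H p + H q - 2 * I" if pq: "p \<in> X" "q \<in> X" for p q
  proof -
    define m where "m = (1 / 2) *\<^sub>R p + (1 / 2) *\<^sub>R q"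
    have m: "m \<in> X" "G m \<le> 1 / 2 * G p + 1 / 2 * G q"
      using convexD[of X p q "1 / 2" "1 / 2"] convex_onD[OF G(1), of "1 / 2" p q] G(1) pq
      by (auto simp: convex_on_def m_def)
    have ma: "m - a = (1 / 2) *\<^sub>R ((p - a) + (q - a))"
      by (simp add: m_def algebra_simps flip: scaleR_add_left)
    have pq': "p - q = (p - a) - (q - a)" by simp
    have "(norm (m - a))\<^sup>2 = (norm (p - a))\<^sup>2 / 2 + (norm (q - a))\<^sup>2 / 2 - (norm (p - q))\<^sup>2 / 4"
      unfolding ma pq' power2_norm_eq_inner
      by (simp add: inner_add inner_diff inner_commute field_simps)
    then have "c / 2 * (norm (m - a))\<^sup>2
        = c / 2 * ((norm (p - a))\<^sup>2 / 2 + (norm (q - a))\<^sup>2 / 2 - (norm (p - q))\<^sup>2 / 4)"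
      by simp
    then have "H m \<le> (H p + H q) / 2 - c / 8 * (norm (p - q))\<^sup>2"
      using m(2) unfolding H_def by (simp add: algebra_simps)
    then show ?thesis using I_le[OF m(1)] by (simp add: add_divide_distrib)
  qed
  have "Cauchy y"
  proof (rule metric_CauchyI)
    fix e :: real assume e: "e > 0"
    then obtain N where N: "1 / real (Suc N) < c / 8 * e\<^sup>2"
      using c nat_approx_posE[of "c / 8 * e\<^sup>2"] by auto
    have "dist (y j) (y k) < e" if jk: "j \<ge> N" "k \<ge> N" for j k
    proof -
      have "1 / real (Suc j) \<le> 1 / real (Suc N)" "1 / real (Suc k) \<le> 1 / real (Suc N)"
        using jk by (auto simp: field_simps)
      then have "c / 4 * (norm (y j - y k))\<^sup>2 < c / 4 * e\<^sup>2"
        using dist[OF y(1) y(1), of j k] y(2)[of j] y(2)[of k] N by linarith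
      then have "(norm (y j - y k))\<^sup>2 < e\<^sup>2" using c by simp
      then show ?thesis using e by (simp add: dist_norm power_less_imp_less_base)
    qed
    then show "\<exists>N. \<forall>j\<ge>N. \<forall>k\<ge>N. dist (y j) (y k) < e" by blast
  qed
  then obtain v where v: "v \<in> X" "y \<longlonglongrightarrow> v"
    using X(1) y(1) unfolding complete_def by blast
  have "continuous_on X H"
    unfolding H_def by (intro continuous_intros G)
  then have "(\<lambda>k. H (y k)) \<longlonglongrightarrow> H v"
    using v y(1) by (simp add: continuous_on_sequentially comp_def)
  moreover have "(\<lambda>k. I + 1 / real (Suc k)) \<longlonglongrightarrow> I + 0"
    by (intro tendsto_intros LIMSEQ_Suc[OF lim_1_over_n])
  ultimately have "H v \<le> I + 0"
    by (rule LIMSEQ_le) (use y(2) in \<open>auto intro!: exI[of _ 0] less_imp_le\<close>)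
  then have "is_arg_min H (\<lambda>y. y \<in> X) v"
    using v(1) I_le by (auto simp: is_arg_min_def not_less intro: order_trans)
  then show ?thesis unfolding H_def[abs_def] by blast
qed

section \<open>Averages over the components\<close>

definition avg :: "nat \<Rightarrow> (nat \<Rightarrow> 'b::real_vector) \<Rightarrow> 'b" where
  "avg n a = (1 / real n) *\<^sub>R (\<Sum>i=1..n. a i)"

lemma avg_add: "avg n (\<lambda>i. a i + b i) = avg n a + avg n b"
  by (simp add: avg_def sum.distrib scaleR_add_right)

lemma avg_diff: "avg n (\<lambda>i. a i - b i) = avg n a - avg n b"
  by (simp add: avg_def sum_subtractf scaleR_diff_right)

lemma avg_const: "n \<ge> 1 \<Longrightarrow> avg n (\<lambda>i. c) = c"
  by (simp add: avg_def sum_constant_scaleR del: sum_constant)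

lemma avg_mult: "avg n (\<lambda>i. c * a i) = c * avg n a" for c :: real
  by (simp add: avg_def sum_distrib_left[symmetric])

lemma avg_inner: "avg n (\<lambda>i. inner (a i) y) = inner (avg n a) y"
  by (simp add: avg_def inner_sum_left)

lemma avg_mono: "(\<And>i. i \<in> {1..n} \<Longrightarrow> a i \<le> b i) \<Longrightarrow> avg n a \<le> avg n b" for a b :: "nat \<Rightarrow> real"
  unfolding avg_def by (intro scaleR_left_mono sum_mono) auto

lemma avg_nonneg: "(\<And>i. 0 \<le> a i) \<Longrightarrow> 0 \<le> avg n a" for a :: "nat \<Rightarrow> real"
  by (simp add: avg_def sum_nonneg)

lemma avg_in_subspace: "subspace X \<Longrightarrow> (\<And>i. i \<in> {1..n} \<Longrightarrow> a i \<in> X) \<Longrightarrow> avg n a \<in> X"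
  unfolding avg_def by (intro subspace_scale subspace_sum)

lemma avg_fun_upd:
  fixes h :: "nat \<Rightarrow> 'a \<Rightarrow> real"
  assumes "i \<in> {1..n}"
  shows "avg n (\<lambda>j. h j ((\<phi>(i := u)) j)) = avg n (\<lambda>j. h j (\<phi> j)) + (h i u - h i (\<phi> i)) / n"
proof -
  have "(\<Sum>j=1..n. h j ((\<phi>(i := u)) j)) = h i u + (\<Sum>j\<in>{1..n}-{i}. h j (\<phi> j))"
    using assms by (subst sum.remove[of _ i]) (auto intro!: sum.cong)
  moreover have "(\<Sum>j=1..n. h j (\<phi> j)) = h i (\<phi> i) + (\<Sum>j\<in>{1..n}-{i}. h j (\<phi> j))"
    using assms by (subst sum.remove[of _ i]) auto
  ultimately show ?thesis by (simp add: avg_def diff_divide_distrib add_divide_distrib)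
qed

lemma variance_le_second_moment:
  fixes a :: "nat \<Rightarrow> 'b::real_inner"
  assumes "n \<ge> 1"
  shows "avg n (\<lambda>i. (norm (avg n a - a i))\<^sup>2) \<le> avg n (\<lambda>i. (norm (a i))\<^sup>2)"
proof -
  have "(norm (avg n a - a i))\<^sup>2 = (norm (a i))\<^sup>2 - 2 * inner (a i) (avg n a) + (norm (avg n a))\<^sup>2" for i
    by (simp add: power2_norm_eq_inner inner_diff inner_commute)
  then have "avg n (\<lambda>i. (norm (avg n a - a i))\<^sup>2)
      = avg n (\<lambda>i. (norm (a i))\<^sup>2) - 2 * inner (avg n a) (avg n a) + (norm (avg n a))\<^sup>2"
    by (simp add: avg_add avg_diff avg_mult avg_inner avg_const[OF assms])
  then show ?thesis by (simp add: power2_norm_eq_inner)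
qed

lemma expectation_uniform:
  fixes h :: "nat \<Rightarrow> real"
  assumes "n \<ge> 1"
  shows "measure_pmf.expectation (pmf_of_set {1..n}) h = avg n h"
  using assms by (subst integral_pmf_of_set) (auto simp: avg_def)

lemma expectation_bind:
  fixes h :: "'b \<Rightarrow> real"
  assumes "finite (set_pmf p)" "\<And>x. x \<in> set_pmf p \<Longrightarrow> finite (set_pmf (q x))"
  shows "measure_pmf.expectation (bind_pmf p q) h
    = measure_pmf.expectation p (\<lambda>x. measure_pmf.expectation (q x) h)"
  using assms by (simp add: pmf_expectation_bind[of "set_pmf p"] integral_measure_pmf[of "set_pmf p"])

lemma expectation_mono:
  fixes h k :: "'b \<Rightarrow> real"
  assumes "finite (set_pmf p)" "\<And>x. x \<in> set_pmf p \<Longrightarrow> h x \<le> k x"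
  shows "measure_pmf.expectation p h \<le> measure_pmf.expectation p k"
  using assms by (intro integral_mono_AE integrable_measure_pmf_finite) (auto simp: AE_measure_pmf_iff)

section \<open>The composite problem\<close>

text \<open>The constant \<open>L\<close> is common to all components, and the smoothness assumption includes
  \<open>L > 0\<close> and that \<open>X\<close> is a subspace.\<close>

locale composite =
  fixes X :: "'a::real_inner set" and n :: nat and f :: "nat \<Rightarrow> 'a \<Rightarrow> real"
    and R :: "'a \<Rightarrow> real" and L :: real and x_star :: 'a
  assumes complete: "complete X" and n: "n \<ge> 1"
    and smooth: "i \<in> {1..n} \<Longrightarrow> smooth_convex X (f i) (gradient X (f i)) L"
    and convex_R: "convex_on X R" and continuous_R: "continuous_on X R"
    and minimizer: "is_arg_min (objective n f R) (\<lambda>x. x \<in> X) x_star"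
begin

abbreviation "P \<equiv> objective n f R"
abbreviation "F x \<equiv> avg n (\<lambda>i. f i x)"
abbreviation "gradF x \<equiv> avg n (\<lambda>i. gradient X (f i) x)"

text \<open>The quantity \<open>B\<^sub>t\<close> of the introduction: how far the table of stored gradients is from the
  gradients at the minimizer.\<close>

definition table_error :: "(nat \<Rightarrow> 'a) \<Rightarrow> real" where
  "table_error \<phi> = avg n (\<lambda>i. (norm (gradient X (f i) (\<phi> i) - gradient X (f i) x_star))\<^sup>2)"

lemma P_eq: "P x = F x + R x"
  by (simp add: objective_def avg_def)

lemma subspace: "subspace X" and L_pos: "L > 0"
  using smooth[of 1] n by (auto simp: smooth_convex_def)

lemma x_star_in: "x_star \<in> X" and x_star_min: "y \<in> X \<Longrightarrow> P x_star \<le> P y"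
  using minimizer by (auto simp: is_arg_min_def not_less)

lemma grad_in: "i \<in> {1..n} \<Longrightarrow> x \<in> X \<Longrightarrow> gradient X (f i) x \<in> X"
  using smooth by (blast dest: smooth_convex.grad_in)

lemma combination_in: "x \<in> X \<Longrightarrow> y \<in> X \<Longrightarrow> a *\<^sub>R x + b *\<^sub>R y \<in> X"
  by (intro subspace_add subspace_scale subspace)

lemma F_cocoercive:
  assumes "x \<in> X" "y \<in> X"
  shows "F y \<ge> F x + inner (gradF x) (y - x)
    + 1 / (2 * L) * avg n (\<lambda>i. (norm (gradient X (f i) y - gradient X (f i) x))\<^sup>2)"
proof -
  have "avg n (\<lambda>i. f i x + inner (gradient X (f i) x) (y - x)
      + 1 / (2 * L) * (norm (gradient X (f i) y - gradient X (f i) x))\<^sup>2) \<le> F y"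
    by (intro avg_mono smooth_convex.cocoercive[OF smooth] assms)
  then show ?thesis unfolding avg_add avg_inner avg_mult .
qed

lemma F_above_tangent:
  assumes "x \<in> X" "y \<in> X"
  shows "F y \<ge> F x + inner (gradF x) (y - x)"
proof -
  have "0 \<le> 1 / (2 * L) * avg n (\<lambda>i. (norm (gradient X (f i) y - gradient X (f i) x))\<^sup>2)"
    using L_pos by (intro mult_nonneg_nonneg avg_nonneg) auto
  then show ?thesis using F_cocoercive[OF assms] by linarith
qed

lemma F_below_parabola:
  assumes "x \<in> X" "y \<in> X"
  shows "F y \<le> F x + inner (gradF x) (y - x) + L / 2 * (norm (y - x))\<^sup>2"
proof -
  have "F y \<le> avg n (\<lambda>i. f i x + inner (gradient X (f i) x) (y - x) + L / 2 * (norm (y - x))\<^sup>2)"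
    by (intro avg_mono smooth_convex.below_parabola[OF smooth] assms)
  then show ?thesis unfolding avg_add avg_inner avg_const[OF n] .
qed

text \<open>First-order optimality, which says that \<open>-\<nabla>F(x\<^sub>*)\<close> is a subgradient of \<open>R\<close> at \<open>x\<^sub>*\<close>.  It is
  used to bound the initial table error and as the affine minorant in the proximal problems.\<close>

lemma subgradient_at_minimizer:
  assumes y: "y \<in> X"
  shows "R y \<ge> R x_star - inner (gradF x_star) (y - x_star)"
proof -
  define A where "A = inner (gradF x_star) (y - x_star) + R y - R x_star"
  have "- (L / 2 * t * (norm (y - x_star))\<^sup>2) \<le> A" if t: "0 < t" "t < 1" for t
  proof -
    let ?z = "(1 - t) *\<^sub>R x_star + t *\<^sub>R y"
    have z: "?z \<in> X" by (intro combination_in x_star_in y)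
    have zx: "?z - x_star = t *\<^sub>R (y - x_star)" by (simp add: algebra_simps)
    have "P x_star \<le> F ?z + R ?z" using x_star_min[OF z] by (simp add: P_eq)
    moreover have "F ?z \<le> F x_star + t * inner (gradF x_star) (y - x_star) + L / 2 * t\<^sup>2 * (norm (y - x_star))\<^sup>2"
      using F_below_parabola[OF x_star_in z] unfolding zx by (simp add: power_mult_distrib)
    moreover have "R ?z \<le> (1 - t) * R x_star + t * R y"
      using convex_onD[OF convex_R, of t x_star y] t x_star_in y by simp
    ultimately have "0 \<le> t * A + L / 2 * t\<^sup>2 * (norm (y - x_star))\<^sup>2"
      unfolding P_eq A_def by (simp add: algebra_simps)
    then have "t * (- (L / 2 * t * (norm (y - x_star))\<^sup>2)) \<le> t * A"
      by (simp add: power2_eq_square algebra_simps)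
    then show ?thesis using t by (simp only: mult_le_cancel_left_pos)
  qed
  then have "\<forall>\<^sub>F t in at_right 0. - (L / 2 * t * (norm (y - x_star))\<^sup>2) \<le> A"
    by (auto simp: eventually_at_right_field intro!: exI[of _ 1])
  moreover have "((\<lambda>t. - (L / 2 * t * (norm (y - x_star))\<^sup>2)) \<longlongrightarrow> - (L / 2 * 0 * (norm (y - x_star))\<^sup>2)) (at_right 0)"
    by (intro tendsto_intros)
  ultimately have "- (L / 2 * 0 * (norm (y - x_star))\<^sup>2) \<le> A"
    by (intro tendsto_upperbound) auto
  then show ?thesis by (simp add: A_def)
qed

lemma initial_table_error:
  assumes x: "x \<in> X"
  shows "table_error (\<lambda>i. x) \<le> 2 * L * (P x - P x_star)"
proof -
  have "1 / (2 * L) * table_error (\<lambda>i. x) \<le> P x - P x_star"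
    using F_cocoercive[OF x_star_in x] subgradient_at_minimizer[OF x]
    by (simp add: table_error_def P_eq)
  then show ?thesis using L_pos by (simp add: field_simps)
qed

text \<open>All three inputs of existence come from the problem: convexity and continuity of \<open>R\<close>, and
  the minorant of \<open>R\<close> at \<open>x\<^sub>*\<close>.\<close>

lemma arg_min_prox:
  assumes "c > 0"
  shows "is_arg_min (\<lambda>y. inner g y + R y + c / 2 * (norm (y - a))\<^sup>2) (\<lambda>y. y \<in> X)
    (arg_min (\<lambda>y. inner g y + R y + c / 2 * (norm (y - a))\<^sup>2) (\<lambda>y. y \<in> X))"
proof -
  have "convex_on X (\<lambda>y. inner g y + R y)"
    using convex_R subspace_imp_convex[OF subspace]
    by (intro convex_on_add) (auto simp: convex_on_def inner_add_right)
  moreover have "continuous_on X (\<lambda>y. inner g y + R y)"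
    by (intro continuous_intros continuous_R)
  moreover have "inner g y + R y \<ge> R x_star + inner (gradF x_star) x_star + inner (g - gradF x_star) y"
    if "y \<in> X" for y
    using subgradient_at_minimizer[OF that] by (simp add: inner_diff)
  ultimately have "\<exists>v. is_arg_min (\<lambda>y. inner g y + R y + c / 2 * (norm (y - a))\<^sup>2) (\<lambda>y. y \<in> X) v"
    using complete x_star_in assms by (intro prox_exists) auto
  then show ?thesis unfolding arg_min_def by (rule someI_ex)
qed

end

section \<open>One iteration\<close>

context composite
begin

text \<open>The function \<open>\<psi>\<^sub>t\<close>, with \<open>g\<^sub>1 + \<dots> + g\<^sub>t\<close> recovered from the running mean \<open>gbar\<close>.\<close>

definition dual_objective :: "'a \<Rightarrow> nat \<Rightarrow> 'a \<Rightarrow> 'a \<Rightarrow> real" where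
  "dual_objective v0 t gbar y = real t * (inner gbar y + R y) + 5 * L / 2 * (norm (y - v0))\<^sup>2"

text \<open>For \<open>t = 0\<close> and \<open>v0 \<in> X\<close> the last two conditions say \<open>v = v0\<close> and \<open>u = v\<close>, so that the initial
  state is covered as well.\<close>

definition loop_invariant :: "'a \<Rightarrow> nat \<Rightarrow> 'a sada_state \<Rightarrow> bool" where
  "loop_invariant v0 t = (\<lambda>(\<phi>, gbar, v, x, u). (\<forall>i. \<phi> i \<in> X) \<and> gbar \<in> X \<and> x \<in> X \<and>
     is_arg_min (dual_objective v0 t gbar) (\<lambda>y. y \<in> X) v \<and>
     u = (1 - 1 / real (t + 1)) *\<^sub>R x + (1 / real (t + 1)) *\<^sub>R v)"

text \<open>Everything needed for the telescoping sum is determined by the current state, so the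
  analysis never refers to the history of the loop.\<close>

definition potential :: "'a \<Rightarrow> nat \<Rightarrow> 'a sada_state \<Rightarrow> real" where
  "potential v0 t = (\<lambda>(\<phi>, gbar, v, x, u).
     real t * (P x - P x_star) - (dual_objective v0 t gbar v - dual_objective v0 t gbar x_star)
     + real n / (4 * L) * table_error \<phi>)"

definition estimator :: "(nat \<Rightarrow> 'a) \<Rightarrow> 'a \<Rightarrow> nat \<Rightarrow> 'a" where
  "estimator \<phi> u i = gradient X (f i) u - gradient X (f i) (\<phi> i) + avg n (\<lambda>j. gradient X (f j) (\<phi> j))"

lemma avg_estimator: "avg n (estimator \<phi> u) = gradF u"
  unfolding estimator_def[abs_def] by (simp add: avg_add avg_diff avg_const[OF n])

lemma estimator_in: "i \<in> {1..n} \<Longrightarrow> u \<in> X \<Longrightarrow> (\<And>j. \<phi> j \<in> X) \<Longrightarrow> estimator \<phi> u i \<in> X"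
  unfolding estimator_def
  by (intro subspace_add subspace_diff subspace grad_in avg_in_subspace) auto

text \<open>The deviation of the estimator is that of
  \<open>\<nabla>f\<^sub>i(u) - \<nabla>f\<^sub>i(\<phi>\<^sub>i)\<close> from its mean, hence bounded by the second moment, which is split at
  \<open>\<nabla>f\<^sub>i(x\<^sub>*)\<close>.\<close>

lemma estimator_variance:
  "avg n (\<lambda>i. (norm (gradF u - estimator \<phi> u i))\<^sup>2)
    \<le> 2 * table_error (\<lambda>i. u) + 2 * table_error \<phi>"
proof -
  let ?a = "\<lambda>i. gradient X (f i) u - gradient X (f i) (\<phi> i)"
  have "gradF u - estimator \<phi> u i = avg n ?a - ?a i" for i
    by (simp add: estimator_def avg_diff)
  then have "avg n (\<lambda>i. (norm (gradF u - estimator \<phi> u i))\<^sup>2) \<le> avg n (\<lambda>i. (norm (?a i))\<^sup>2)"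
    using variance_le_second_moment[OF n, of ?a] by simp
  also have "\<dots> \<le> avg n (\<lambda>i. 2 * (norm (gradient X (f i) u - gradient X (f i) x_star))\<^sup>2
      + 2 * (norm (gradient X (f i) (\<phi> i) - gradient X (f i) x_star))\<^sup>2)"
  proof (rule avg_mono)
    fix i
    let ?p = "gradient X (f i) u - gradient X (f i) x_star"
    let ?q = "gradient X (f i) (\<phi> i) - gradient X (f i) x_star"
    have "(norm (a - b))\<^sup>2 \<le> 2 * (norm a)\<^sup>2 + 2 * (norm b)\<^sup>2" for a b :: 'a
    proof -
      have "0 \<le> (norm (a + b))\<^sup>2" by simp
      also have "\<dots> = 2 * (norm a)\<^sup>2 + 2 * (norm b)\<^sup>2 - (norm (a - b))\<^sup>2"
        by (simp add: power2_norm_eq_inner inner_add inner_diff inner_commute)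
      finally show ?thesis by simp
    qed
    from this[of ?p ?q] show "(norm (?a i))\<^sup>2 \<le> 2 * (norm ?p)\<^sup>2 + 2 * (norm ?q)\<^sup>2" by simp
  qed
  also have "\<dots> = 2 * table_error (\<lambda>i. u) + 2 * table_error \<phi>"
    by (simp add: avg_add avg_mult table_error_def)
  finally show ?thesis .
qed

lemma expected_table_error:
  "avg n (\<lambda>i. table_error (\<phi>(i := u))) = table_error \<phi> + (table_error (\<lambda>i. u) - table_error \<phi>) / n"
proof -
  let ?h = "\<lambda>j z. (norm (gradient X (f j) z - gradient X (f j) x_star))\<^sup>2"
  have "table_error (\<phi>(i := u)) = table_error \<phi> + 1 / n * (?h i u - ?h i (\<phi> i))" if "i \<in> {1..n}" for i
    using avg_fun_upd[OF that, of ?h \<phi> u] by (simp add: table_error_def)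
  then have "avg n (\<lambda>i. table_error (\<phi>(i := u))) = avg n (\<lambda>i. table_error \<phi> + 1 / n * (?h i u - ?h i (\<phi> i)))"
    unfolding avg_def by (intro arg_cong2[of _ _ _ _ scaleR] sum.cong) auto
  also have "\<dots> = table_error \<phi> + 1 / n * (table_error (\<lambda>i. u) - table_error \<phi>)"
    unfolding avg_add avg_const[OF n] avg_mult avg_diff by (simp add: table_error_def)
  finally show ?thesis by simp
qed

text \<open>The objective that defines \<open>v'\<close>, multiplied by \<open>t + 1\<close>, is the dual objective
  of step \<open>t + 1\<close>.  These four facts are all that the analysis uses about an update.\<close>

lemma sada_update_step:
  assumes inv: "loop_invariant v0 t (\<phi>, gbar, v, x, u)" and v0: "v0 \<in> X" and i: "i \<in> {1..n}"
  obtains gbar' v' x' u' where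
    "sada_update X n f R (5 * L) v0 (Suc t) i (\<phi>, gbar, v, x, u) = (\<phi>(i := u), gbar', v', x', u')"
    "loop_invariant v0 (Suc t) (\<phi>(i := u), gbar', v', x', u')"
    "\<And>y. dual_objective v0 (Suc t) gbar' y
        = dual_objective v0 t gbar y + inner (estimator \<phi> u i) y + R y"
    "\<And>y. y \<in> X \<Longrightarrow> inner (estimator \<phi> u i) x' + R x' + 5 * L * real (Suc t) / 2 * (norm (x' - u))\<^sup>2
        \<le> inner (estimator \<phi> u i) y + R y + 5 * L * real (Suc t) / 2 * (norm (y - u))\<^sup>2"
proof -
  let ?T = "real (Suc t)"
  define g where "g = estimator \<phi> u i"
  define gbar' where "gbar' = (1 - 1 / ?T) *\<^sub>R gbar + (1 / ?T) *\<^sub>R g"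
  define v' where "v' = arg_min (\<lambda>y. inner gbar' y + R y + 5 * L / (2 * ?T) * (norm (y - v0))\<^sup>2) (\<lambda>y. y \<in> X)"
  define x' where "x' = arg_min (\<lambda>y. inner g y + R y + 5 * L * ?T / 2 * (norm (y - u))\<^sup>2) (\<lambda>y. y \<in> X)"
  define u' where "u' = (1 - 1 / real (Suc t + 1)) *\<^sub>R x' + (1 / real (Suc t + 1)) *\<^sub>R v'"
  have upd: "sada_update X n f R (5 * L) v0 (Suc t) i (\<phi>, gbar, v, x, u) = (\<phi>(i := u), gbar', v', x', u')"
    by (simp add: sada_update_def Let_def g_def estimator_def avg_def gbar'_def v'_def x'_def u'_def)
  have inX: "\<And>j. \<phi> j \<in> X" "gbar \<in> X" "x \<in> X" "v \<in> X" "u \<in> X"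
    using inv by (auto simp: loop_invariant_def is_arg_min_def intro: combination_in)
  have gbar': "gbar' \<in> X"
    unfolding gbar'_def g_def using i inX by (intro combination_in estimator_in) auto
  have x': "is_arg_min (\<lambda>y. inner g y + R y + 5 * L * ?T / 2 * (norm (y - u))\<^sup>2) (\<lambda>y. y \<in> X) x'"
    unfolding x'_def using L_pos by (intro arg_min_prox) simp
  have dual: "dual_objective v0 (Suc t) gbar' y
      = ?T * (inner gbar' y + R y + 5 * L / (2 * ?T) * (norm (y - v0))\<^sup>2)" for y
    unfolding dual_objective_def by (simp add: distrib_left del: of_nat_Suc)
  have "is_arg_min (\<lambda>y. inner gbar' y + R y + (5 * L / ?T) / 2 * (norm (y - v0))\<^sup>2) (\<lambda>y. y \<in> X) v'"
    unfolding v'_def using L_pos arg_min_prox[of "5 * L / ?T" gbar' v0] by (simp add: mult.commute del: of_nat_Suc)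
  then have v': "is_arg_min (dual_objective v0 (Suc t) gbar') (\<lambda>y. y \<in> X) v'"
    by (simp add: is_arg_min_def dual mult.commute[of 2] del: of_nat_Suc)
  have "loop_invariant v0 (Suc t) (\<phi>(i := u), gbar', v', x', u')"
    using inX gbar' x' v' by (auto simp: loop_invariant_def u'_def is_arg_min_def)
  moreover have "dual_objective v0 (Suc t) gbar' y = dual_objective v0 t gbar y + inner g y + R y" for y
  proof -
    have "?T *\<^sub>R gbar' = real t *\<^sub>R gbar + g"
      by (simp add: gbar'_def scaleR_add_right right_diff_distrib del: of_nat_Suc)
    then have "?T * inner gbar' y = real t * inner gbar y + inner g y"
      by (metis inner_add_left inner_scaleR_left)
    then show ?thesis by (simp add: dual_objective_def distrib_left del: of_nat_Suc) (simp add: algebra_simps)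
  qed
  moreover have "inner g x' + R x' + 5 * L * ?T / 2 * (norm (x' - u))\<^sup>2
      \<le> inner g y + R y + 5 * L * ?T / 2 * (norm (y - u))\<^sup>2" if "y \<in> X" for y
    using x' that by (auto simp: is_arg_min_def not_less)
  ultimately show thesis
    by (rule that[OF upd, folded g_def])
qed

lemma dual_growth:
  assumes inv: "loop_invariant v0 t (\<phi>, gbar, v, x, u)" and y: "y \<in> X"
  shows "dual_objective v0 t gbar v + 5 * L / 2 * (norm (y - v))\<^sup>2 \<le> dual_objective v0 t gbar y"
proof -
  have "convex_on X (\<lambda>y. real t * (inner gbar y + R y))"
    using convex_R subspace_imp_convex[OF subspace]
    by (intro convex_on_cmul convex_on_add) (auto simp: convex_on_def inner_add_right)
  then show ?thesis
    using inv quadratic_growth_at_minimizer[of X "\<lambda>y. real t * (inner gbar y + R y)" v y "5 * L" v0] y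
    by (auto simp: loop_invariant_def is_arg_min_def dual_objective_def not_less)
qed

text \<open>The deterministic part of the argument, valid for an arbitrary vector \<open>g\<close> in place of the
  gradient of \<open>F\<close>.\<close>

lemma one_step_descent:
  assumes inv: "loop_invariant v0 t (\<phi>, gbar, v, x, u)"
    and inv': "loop_invariant v0 (Suc t) (\<phi>', gbar', v', x', u')"
    and dual: "\<And>y. dual_objective v0 (Suc t) gbar' y = dual_objective v0 t gbar y + inner g y + R y"
    and x'min: "\<And>y. y \<in> X \<Longrightarrow> inner g x' + R x' + 5 * L * real (Suc t) / 2 * (norm (x' - u))\<^sup>2
        \<le> inner g y + R y + 5 * L * real (Suc t) / 2 * (norm (y - u))\<^sup>2"
  shows "real (Suc t) * P x' - dual_objective v0 (Suc t) gbar' v'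
    \<le> real (Suc t) * F u + inner g (real t *\<^sub>R x - real (Suc t) *\<^sub>R u) + real t * R x
      - dual_objective v0 t gbar v + 1 / (8 * L) * (norm (gradF u - g))\<^sup>2"
proof -
  define T where "T = real (Suc t)"
  have T: "T \<ge> 1" "real t = T - 1" by (auto simp: T_def)
  have inX: "x \<in> X" "v \<in> X" "u \<in> X" "x' \<in> X" "v' \<in> X"
    using inv inv' by (auto simp: loop_invariant_def is_arg_min_def intro: combination_in)
  have u: "u = (1 - 1 / T) *\<^sub>R x + (1 / T) *\<^sub>R v"
    using inv by (simp add: loop_invariant_def T_def add.commute)
  \<comment> \<open>the point with which \<open>x'\<close> is compared differs from \<open>u\<close> by \<open>(v' - v) / T\<close>, so its proximal
      penalty, times \<open>T\<close>, is what the dual objective grows by between \<open>v\<close> and \<open>v'\<close>\<close>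
  define y where "y = (1 - 1 / T) *\<^sub>R x + (1 / T) *\<^sub>R v'"
  have y: "y \<in> X" unfolding y_def by (intro combination_in inX)
  have "y - u = (1 / T) *\<^sub>R (v' - v)" by (simp add: y_def u scaleR_diff_right)
  then have yu: "T * (5 * L * T / 2 * (norm (y - u))\<^sup>2) = 5 * L / 2 * (norm (v' - v))\<^sup>2"
    using T by (simp add: power_divide power2_eq_square)
  have Ty: "T * inner g y = real t * inner g x + inner g v'"
    using T by (simp add: y_def inner_add_right distrib_left right_diff_distrib)
  have TRy: "T * R y \<le> real t * R x + R v'"
  proof -
    have "R y \<le> (1 - 1 / T) * R x + 1 / T * R v'"
      using convex_onD[OF convex_R, of "1 / T" x v'] T inX by (simp add: y_def)
    then have "T * R y \<le> T * ((1 - 1 / T) * R x + 1 / T * R v')"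
      using T by (intro mult_left_mono) auto
    also have "\<dots> = real t * R x + R v'"
      using T by (simp add: distrib_left right_diff_distrib left_diff_distrib)
    finally show ?thesis .
  qed
  have "T * (inner g x' + R x' + 5 * L * T / 2 * (norm (x' - u))\<^sup>2)
      \<le> T * (inner g y + R y + 5 * L * T / 2 * (norm (y - u))\<^sup>2)"
    using x'min[OF y] T(1) unfolding T_def by (intro mult_left_mono) auto
  then have prox: "T * inner g x' + T * R x' + T * (5 * L * T / 2 * (norm (x' - u))\<^sup>2)
      \<le> real t * inner g x + inner g v' + real t * R x + R v' + 5 * L / 2 * (norm (v' - v))\<^sup>2"
    using Ty TRy yu unfolding distrib_left by linarith
  have growth: "dual_objective v0 t gbar v + 5 * L / 2 * (norm (v' - v))\<^sup>2 \<le> dual_objective v0 t gbar v'"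
    by (rule dual_growth[OF inv inX(5)])
  define w where "w = gradF u - g"
  define z where "z = x' - u"
  \<comment> \<open>Young's inequality; the choice \<open>\<eta> = 5L\<close> leaves \<open>5LT\<^sup>2/2 - LT/2 \<ge> 2LT\<^sup>2\<close> of the penalty after
      the smoothness term, as \<open>T \<ge> 1\<close>\<close>
  have young: "T * inner w z + T * (L / 2 * (norm z)\<^sup>2)
      \<le> T * (5 * L * T / 2 * (norm z)\<^sup>2) + 1 / (8 * L) * (norm w)\<^sup>2"
  proof -
    have "0 \<le> 1 / (8 * L) * (norm (w - (4 * L * T) *\<^sub>R z))\<^sup>2" using L_pos by simp
    also have "\<dots> = 1 / (8 * L) * (norm w)\<^sup>2 - T * inner w z + 2 * L * T\<^sup>2 * (norm z)\<^sup>2"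
      using L_pos unfolding power2_norm_eq_inner
      by (simp add: inner_diff inner_commute field_simps power2_eq_square)
    finally have "T * inner w z \<le> 1 / (8 * L) * (norm w)\<^sup>2 + 2 * L * T\<^sup>2 * (norm z)\<^sup>2" by simp
    moreover have "L / 2 * (norm z)\<^sup>2 * T \<le> L / 2 * (norm z)\<^sup>2 * T\<^sup>2"
      using T L_pos by (intro mult_left_mono) (auto simp: power2_eq_square)
    ultimately show ?thesis by (simp add: power2_eq_square algebra_simps)
  qed
  have "T * F x' \<le> T * (F u + inner (gradF u) z + L / 2 * (norm z)\<^sup>2)"
    unfolding z_def using T inX by (intro mult_left_mono F_below_parabola) auto
  moreover have "inner (gradF u) z = inner w z + inner g x' - inner g u"
    by (simp add: w_def z_def inner_diff_left inner_diff_right)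
  ultimately have "T * F x' \<le> T * F u + T * inner w z + T * inner g x' - T * inner g u + T * (L / 2 * (norm z)\<^sup>2)"
    by (simp add: algebra_simps)
  then have "T * (F x' + R x') - (dual_objective v0 t gbar v' + inner g v' + R v')
    \<le> T * F u + (real t * inner g x - T * inner g u) + real t * R x
      - dual_objective v0 t gbar v + 1 / (8 * L) * (norm w)\<^sup>2"
    using prox growth young unfolding z_def[symmetric] distrib_left by linarith
  then show ?thesis
    unfolding dual P_eq T_def w_def by (simp add: inner_diff_right)
qed

text \<open>Averaging replaces the estimator by \<open>\<nabla>F(u)\<close>; the variance, the change of the table and
  co-coercivity at \<open>x\<^sub>*\<close> then cancel exactly.\<close>

lemma expected_potential_decreases:
  assumes inv: "loop_invariant v0 t st" and v0: "v0 \<in> X"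
  shows "avg n (\<lambda>i. potential v0 (Suc t) (sada_update X n f R (5 * L) v0 (Suc t) i st)) \<le> potential v0 t st"
proof -
  obtain \<phi> gbar v x u where st: "st = (\<phi>, gbar, v, x, u)" by (cases st) auto
  note inv = inv[unfolded st]
  have inX: "x \<in> X" "u \<in> X"
    using inv by (auto simp: loop_invariant_def is_arg_min_def intro: combination_in)
  define T where "T = real (Suc t)"
  have T: "T = real t + 1" by (simp add: T_def)
  let ?y = "real t *\<^sub>R x - T *\<^sub>R u + x_star"
  let ?c = "T * F u + real t * R x + R x_star - T * P x_star
      - (dual_objective v0 t gbar v - dual_objective v0 t gbar x_star)"
  have step: "potential v0 (Suc t) (sada_update X n f R (5 * L) v0 (Suc t) i st)
     \<le> ?c + inner (estimator \<phi> u i) ?y + 1 / (8 * L) * (norm (gradF u - estimator \<phi> u i))\<^sup>2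
        + real n / (4 * L) * table_error (\<phi>(i := u))" if i: "i \<in> {1..n}" for i
  proof -
    obtain gbar' v' x' u' where
      upd: "sada_update X n f R (5 * L) v0 (Suc t) i (\<phi>, gbar, v, x, u) = (\<phi>(i := u), gbar', v', x', u')"
      and inv': "loop_invariant v0 (Suc t) (\<phi>(i := u), gbar', v', x', u')"
      and dual: "\<And>y. dual_objective v0 (Suc t) gbar' y
        = dual_objective v0 t gbar y + inner (estimator \<phi> u i) y + R y"
      and xmin: "\<And>y. y \<in> X \<Longrightarrow> inner (estimator \<phi> u i) x' + R x' + 5 * L * real (Suc t) / 2 * (norm (x' - u))\<^sup>2
        \<le> inner (estimator \<phi> u i) y + R y + 5 * L * real (Suc t) / 2 * (norm (y - u))\<^sup>2"
      by (rule sada_update_step[OF inv v0 i]) (rule that, assumption+)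
    from one_step_descent[OF inv inv' dual xmin] show ?thesis
      unfolding st upd potential_def prod.case
      unfolding dual[of x_star] T_def[symmetric]
      by (simp add: inner_add_right right_diff_distrib)
  qed
  have "avg n (\<lambda>i. potential v0 (Suc t) (sada_update X n f R (5 * L) v0 (Suc t) i st))
    \<le> avg n (\<lambda>i. ?c + inner (estimator \<phi> u i) ?y + 1 / (8 * L) * (norm (gradF u - estimator \<phi> u i))\<^sup>2
        + real n / (4 * L) * table_error (\<phi>(i := u)))"
    by (rule avg_mono[OF step])
  also have "\<dots> = ?c + inner (gradF u) ?y + 1 / (8 * L) * avg n (\<lambda>i. (norm (gradF u - estimator \<phi> u i))\<^sup>2)
      + real n / (4 * L) * (table_error \<phi> + (table_error (\<lambda>i. u) - table_error \<phi>) / n)"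
    unfolding avg_add avg_const[OF n] avg_mult avg_inner avg_estimator expected_table_error ..
  also have "\<dots> \<le> ?c + inner (gradF u) ?y + 1 / (8 * L) * (2 * table_error (\<lambda>i. u) + 2 * table_error \<phi>)
      + real n / (4 * L) * (table_error \<phi> + (table_error (\<lambda>i. u) - table_error \<phi>) / n)"
    using L_pos by (intro add_mono mult_left_mono estimator_variance) auto
  also have "\<dots> = ?c + inner (gradF u) ?y + 1 / (2 * L) * table_error (\<lambda>i. u)
      + real n / (4 * L) * table_error \<phi>"
    using L_pos n by (simp add: field_simps)
  also have "\<dots> \<le> potential v0 t st"
  proof -
    have "real t * (F u + inner (gradF u) (x - u)) \<le> real t * F x"
      by (intro mult_left_mono F_above_tangent inX) simp
    moreover have "F u + inner (gradF u) (x_star - u) + 1 / (2 * L) * table_error (\<lambda>i. u) \<le> F x_star"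
      using F_cocoercive[OF inX(2) x_star_in] by (simp add: table_error_def norm_minus_commute)
    moreover have "inner (gradF u) ?y = real t * inner (gradF u) (x - u) + inner (gradF u) (x_star - u)"
      unfolding T by (simp add: inner_diff_right inner_add_right algebra_simps)
    ultimately show ?thesis
      unfolding st potential_def prod.case P_eq T by (simp add: algebra_simps)
  qed
  finally show ?thesis .
qed

section \<open>One stage\<close>

abbreviation "inner_loop \<equiv> sada_inner X n f R (5 * L)"

lemma inner_loop_Suc:
  "inner_loop x0 v0 (Suc t) = bind_pmf (inner_loop x0 v0 t) (\<lambda>st.
     map_pmf (\<lambda>i. sada_update X n f R (5 * L) v0 (Suc t) i st) (pmf_of_set {1..n}))"
  by (simp add: map_pmf_def)

lemma finite_inner_loop: "finite (set_pmf (inner_loop x0 v0 t))"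
  using n by (induction t) (auto simp: inner_loop_Suc simp del: sada_inner.simps(2))

lemma inner_loop_invariant:
  assumes "x0 \<in> X" "v0 \<in> X" "st \<in> set_pmf (inner_loop x0 v0 t)"
  shows "loop_invariant v0 t st"
  using assms(3)
proof (induction t arbitrary: st)
  case 0
  then show ?case
    using assms(1,2) L_pos subspace_0[OF subspace]
    by (auto simp: loop_invariant_def is_arg_min_def dual_objective_def not_less)
next
  case (Suc t)
  then obtain st0 i where st0: "st0 \<in> set_pmf (inner_loop x0 v0 t)" and i: "i \<in> {1..n}"
    and st: "st = sada_update X n f R (5 * L) v0 (Suc t) i st0"
    using n by (auto simp: inner_loop_Suc simp del: sada_inner.simps(2))
  obtain \<phi> gbar v x u where "st0 = (\<phi>, gbar, v, x, u)" by (cases st0) auto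
  then show ?case
    using sada_update_step[OF _ assms(2) i, of t \<phi> gbar v x u] Suc.IH[OF st0] st by metis
qed

lemma expectation_inner_loop_Suc:
  "measure_pmf.expectation (inner_loop x0 v0 (Suc t)) h
    = measure_pmf.expectation (inner_loop x0 v0 t)
        (\<lambda>st. avg n (\<lambda>i. h (sada_update X n f R (5 * L) v0 (Suc t) i st)))" for h :: "_ \<Rightarrow> real"
  unfolding inner_loop_Suc using n
  by (subst expectation_bind) (simp_all add: finite_inner_loop expectation_uniform[OF n, simplified])

lemma expected_potential:
  assumes "x0 \<in> X" "v0 \<in> X"
  shows "measure_pmf.expectation (inner_loop x0 v0 t) (potential v0 t)
    \<le> 5 * L / 2 * (norm (v0 - x_star))\<^sup>2 + real n / (4 * L) * table_error (\<lambda>i. x0)"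
proof (induction t)
  case 0
  then show ?case by (simp add: potential_def dual_objective_def norm_minus_commute)
next
  case (Suc t)
  have "measure_pmf.expectation (inner_loop x0 v0 (Suc t)) (potential v0 (Suc t))
      \<le> measure_pmf.expectation (inner_loop x0 v0 t) (potential v0 t)"
    unfolding expectation_inner_loop_Suc
    using inner_loop_invariant[OF assms] assms(2)
    by (intro expectation_mono finite_inner_loop expected_potential_decreases)
  then show ?case using Suc by linarith
qed

text \<open>A table entry survives an iteration with probability \<open>1 - 1/n\<close>.  This lower bound makes the cost
  of the table terms over \<open>m\<close> iterations proportional to \<open>m B\<^sub>0\<close> instead of \<open>n B\<^sub>0\<close>.\<close>

lemma expected_table_error_lower:
  "measure_pmf.expectation (inner_loop x0 v0 t) (\<lambda>st. table_error (fst st))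
    \<ge> (1 - 1 / n) ^ t * table_error (\<lambda>i. x0)"
proof (induction t)
  case 0
  then show ?case by simp
next
  case (Suc t)
  let ?B = "\<lambda>st. table_error (fst st)"
  have "(1 - 1 / n) * ?B st \<le> avg n (\<lambda>i. ?B (sada_update X n f R (5 * L) v0 (Suc t) i st))"
    for st :: "'a sada_state"
  proof -
    obtain \<phi> gbar v x u where st: "st = (\<phi>, gbar, v, x, u)" by (cases st) auto
    have "0 \<le> table_error (\<lambda>i. u) / n" by (simp add: table_error_def avg_nonneg)
    then show ?thesis
      using expected_table_error[of \<phi> u]
      by (simp add: st sada_update_def Let_def diff_divide_distrib algebra_simps)
  qed
  then have "measure_pmf.expectation (inner_loop x0 v0 t) (\<lambda>st. (1 - 1 / n) * ?B st)
      \<le> measure_pmf.expectation (inner_loop x0 v0 (Suc t)) ?B"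
    unfolding expectation_inner_loop_Suc by (intro expectation_mono finite_inner_loop)
  moreover have "(1 - 1 / n) * ((1 - 1 / n) ^ t * table_error (\<lambda>i. x0))
      \<le> (1 - 1 / n) * measure_pmf.expectation (inner_loop x0 v0 t) ?B"
    using Suc n by (intro mult_left_mono) auto
  ultimately show ?case by (simp add: mult.assoc)
qed

text \<open>The distance term on the left comes from the growth of \<open>\<psi>\<^sub>m\<close> around its minimizer
  \<open>v\<close>; the factor \<open>1/2\<close> of the initial gap comes from the table terms and that of the distance is
  due to \<open>2m\<close> being the next stage length.\<close>

lemma stage_halves_potential:
  assumes x0: "x0 \<in> X" and v0: "v0 \<in> X" and m: "m \<ge> 1"
  shows "measure_pmf.expectation (inner_loop x0 v0 m)
      (\<lambda>(\<phi>, gbar, v, x, u). P x - P x_star + 5 * L / (2 * m) * (norm (v - x_star))\<^sup>2)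
    \<le> 1 / 2 * (P x0 - P x_star + 5 * L / m * (norm (v0 - x_star))\<^sup>2)"
proof -
  let ?E = "measure_pmf.expectation (inner_loop x0 v0 m)"
  let ?h = "\<lambda>(\<phi>, gbar, v, x, u). P x - P x_star + 5 * L / (2 * m) * (norm (v - x_star))\<^sup>2"
  let ?B = "\<lambda>st. table_error (fst st)"
  let ?initial = "table_error (\<lambda>i. x0)"
  have int: "integrable (inner_loop x0 v0 m) h" for h :: "'a sada_state \<Rightarrow> real"
    by (rule integrable_measure_pmf_finite[OF finite_inner_loop])
  have "real m * ?h st + real n / (4 * L) * ?B st \<le> potential v0 m st"
    if "st \<in> set_pmf (inner_loop x0 v0 m)" for st
  proof -
    obtain \<phi> gbar v x u where st: "st = (\<phi>, gbar, v, x, u)" by (cases st) auto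
    have inv: "loop_invariant v0 m (\<phi>, gbar, v, x, u)"
      using inner_loop_invariant[OF x0 v0 that] st by simp
    have "dual_objective v0 m gbar v + 5 * L / 2 * (norm (x_star - v))\<^sup>2 \<le> dual_objective v0 m gbar x_star"
      using inv by (rule dual_growth[OF _ x_star_in])
    then show ?thesis
      using m by (simp add: st potential_def norm_minus_commute distrib_left)
  qed
  then have "?E (\<lambda>st. real m * ?h st + real n / (4 * L) * ?B st) \<le> ?E (potential v0 m)"
    by (rule expectation_mono[OF finite_inner_loop])
  then have "real m * ?E ?h + real n / (4 * L) * ?E ?B \<le> ?E (potential v0 m)"
    by (simp add: int)
  moreover have "real n / (4 * L) * ?E ?B \<ge> real n / (4 * L) * ?initial - real m / (4 * L) * ?initial"
  proof -
    have "1 - real m / n \<le> (1 - 1 / n) ^ m"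
      using Bernoulli_inequality[of "- (1 / real n)" m] n by simp
    then have "(1 - real m / n) * ?initial \<le> (1 - 1 / n) ^ m * ?initial"
      by (intro mult_right_mono) (simp_all add: table_error_def avg_nonneg)
    also have "\<dots> \<le> ?E ?B" by (rule expected_table_error_lower)
    finally have "real n / (4 * L) * ((1 - real m / n) * ?initial) \<le> real n / (4 * L) * ?E ?B"
      using L_pos by (intro mult_left_mono) auto
    moreover have "real n / (4 * L) * ((1 - real m / n) * ?initial) = real n / (4 * L) * ?initial - real m / (4 * L) * ?initial"
      using n by (simp add: left_diff_distrib right_diff_distrib)
    ultimately show ?thesis by simp
  qed
  moreover have "real m / (4 * L) * ?initial \<le> real m / 2 * (P x0 - P x_star)"
  proof -
    have "real m / (4 * L) * ?initial \<le> real m / (4 * L) * (2 * L * (P x0 - P x_star))"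
      using L_pos initial_table_error[OF x0] by (intro mult_left_mono) auto
    also have "\<dots> = real m / 2 * (P x0 - P x_star)" using L_pos by simp
    finally show ?thesis .
  qed
  ultimately have "real m * ?E ?h \<le> real m / 2 * (P x0 - P x_star) + 5 * L / 2 * (norm (v0 - x_star))\<^sup>2"
    using expected_potential[OF x0 v0, of m] by linarith
  also have "\<dots> = real m * (1 / 2 * (P x0 - P x_star + 5 * L / m * (norm (v0 - x_star))\<^sup>2))"
    using m by (simp add: distrib_left)
  finally show ?thesis using m by (simp only: mult_le_cancel_left_pos of_nat_0_less_iff)
qed

end

section \<open>Successive stages\<close>

context composite
begin

lemma sada_support:
  assumes "x_init \<in> X"
  shows "finite (set_pmf (sada X n f R (5 * L) m1 0 x_init s))"
    and "set_pmf (sada X n f R (5 * L) m1 0 x_init s) \<subseteq> X \<times> X"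
proof (induction s)
  case 0
  { case 1 show ?case by simp }
  { case 2 show ?case using assms by simp }
next
  case (Suc s)
  { case 1 show ?case using Suc.IH(1) by (auto simp: finite_inner_loop) }
  { case 2
    show ?case
    proof
      fix y assume "y \<in> set_pmf (sada X n f R (5 * L) m1 0 x_init (Suc s))"
      then obtain x0 v0 \<phi> gbar v x u where "(x0, v0) \<in> set_pmf (sada X n f R (5 * L) m1 0 x_init s)"
        and st: "(\<phi>, gbar, v, x, u) \<in> set_pmf (inner_loop x0 v0 (stage_length m1 (Suc s)))" and y: "y = (x, v)"
        by auto
      then have "loop_invariant v0 (stage_length m1 (Suc s)) (\<phi>, gbar, v, x, u)"
        using Suc.IH(2) by (intro inner_loop_invariant[of x0 v0 "(\<phi>, gbar, v, x, u)"]) auto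
      then show "y \<in> X \<times> X" by (auto simp: y loop_invariant_def is_arg_min_def)
    qed }
qed

text \<open>The distance coefficient is \<open>5L\<close> divided by the length of the coming stage, which makes the
  stages compose.\<close>

lemma sada_potential:
  assumes x_init: "x_init \<in> X" and m1: "m1 \<ge> 1"
  shows "measure_pmf.expectation (sada X n f R (5 * L) m1 0 x_init S)
      (\<lambda>(x, v). P x - P x_star + 5 * L / (2 ^ S * m1) * (norm (v - x_star))\<^sup>2)
    \<le> 1 / 2 ^ S * (P x_init - P x_star + 5 * L / m1 * (norm (x_init - x_star))\<^sup>2)"
proof (induction S)
  case 0
  show ?case by simp
next
  case (Suc S)
  let ?p = "sada X n f R (5 * L) m1 0 x_init S"
  let ?m = "stage_length m1 (Suc S)"
  let ?h = "\<lambda>S (x, v). P x - P x_star + 5 * L / (2 ^ S * m1) * (norm (v - x_star))\<^sup>2"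
  have m: "?m \<ge> 1" "real ?m = 2 ^ S * m1" using m1 by (simp_all add: stage_length_def)
  have "measure_pmf.expectation (sada X n f R (5 * L) m1 0 x_init (Suc S)) (?h (Suc S))
      = measure_pmf.expectation ?p (\<lambda>(x0, v0). measure_pmf.expectation (inner_loop x0 v0 ?m)
          (\<lambda>(\<phi>, gbar, v, x, u). P x - P x_star + 5 * L / (2 * ?m) * (norm (v - x_star))\<^sup>2))"
    by (simp add: expectation_bind sada_support[OF x_init] finite_inner_loop case_prod_unfold m(2) mult.assoc)
  also have "\<dots> \<le> measure_pmf.expectation ?p (\<lambda>y. 1 / 2 * ?h S y)"
  proof (rule expectation_mono[OF sada_support(1)[OF x_init]])
    fix y assume "y \<in> set_pmf ?p"
    then obtain x0 v0 where y: "y = (x0, v0)" and in_X: "x0 \<in> X" "v0 \<in> X"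
      using sada_support(2)[OF x_init] by blast
    show "(case y of (x0, v0) \<Rightarrow> measure_pmf.expectation (inner_loop x0 v0 ?m)
          (\<lambda>(\<phi>, gbar, v, x, u). P x - P x_star + 5 * L / (2 * ?m) * (norm (v - x_star))\<^sup>2))
        \<le> 1 / 2 * ?h S y"
      using stage_halves_potential[OF in_X m(1)] unfolding y prod.case m(2) .
  qed
  also have "\<dots> = 1 / 2 * measure_pmf.expectation ?p (?h S)" by (rule integral_mult_right_zero)
  also have "\<dots> \<le> 1 / 2 * (1 / 2 ^ S * (P x_init - P x_star + 5 * L / m1 * (norm (x_init - x_star))\<^sup>2))"
    by (intro mult_left_mono Suc.IH) simp
  finally show ?case by simp
qed

lemma expected_gap_bound:
  assumes "x_init \<in> X" and m1: "m1 \<ge> 1"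
  shows "expected_gap X n f R (5 * L) m1 0 x_init x_star S
    \<le> 1 / 2 ^ S * (P x_init - P x_star + 5 * L / m1 * (norm (x_init - x_star))\<^sup>2)"
proof -
  have "expected_gap X n f R (5 * L) m1 0 x_init x_star S
    \<le> measure_pmf.expectation (sada X n f R (5 * L) m1 0 x_init S)
        (\<lambda>(x, v). P x - P x_star + 5 * L / (2 ^ S * m1) * (norm (v - x_star))\<^sup>2)"
    unfolding expected_gap_def using L_pos
    by (intro expectation_mono sada_support assms) auto
  then show ?thesis using sada_potential[OF assms] by (rule order_trans)
qed

end

lemma composite_problem_imp_composite:
  assumes "composite_problem (euclidean_nspace d) n f L R \<mu> x_star"
  shows "composite (euclidean_nspace d) n f R (L_max n L) x_star"
proof (rule composite.intro)
  let ?X = "euclidean_nspace d"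
  note prob = assms[unfolded composite_problem_def strongly_convex_def]
  show "complete ?X" by (rule complete_euclidean_nspace)
  show "1 \<le> n" "convex_on ?X R" "is_arg_min (objective n f R) (\<lambda>x. x \<in> ?X) x_star"
    using prob by auto
  then show "continuous_on ?X R"
    by (intro convex_on_euclidean_nspace_continuous)
  fix i assume i: "i \<in> {1..n}"
  then have fi: "convex_on ?X (f i)" "f i differentiable_on ?X" "(L i)-lipschitz_on ?X (gradient ?X (f i))"
    using prob by auto
  have Li: "L i \<le> L_max n L"
    unfolding L_max_def using i by (intro Max_ge) auto
  show "smooth_convex ?X (f i) (gradient ?X (f i)) (L_max n L)"
  proof
    show "subspace ?X" by (rule subspace_euclidean_nspace)
    show "convex_on ?X (f i)" by (rule fi)
    show "0 < L_max n L" using prob by auto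
    fix x assume x: "x \<in> ?X"
    with fi(2) have "f i differentiable (at x within ?X)" by (auto simp: differentiable_on_def)
    from gradient_euclidean_nspace[OF this x]
    show "(f i has_derivative inner (gradient ?X (f i) x)) (at x within ?X)"
      and "gradient ?X (f i) x \<in> ?X" by auto
    fix y assume "y \<in> ?X"
    then have "norm (gradient ?X (f i) x - gradient ?X (f i) y) \<le> L i * norm (x - y)"
      using lipschitz_onD[OF fi(3) x] by (simp add: dist_norm)
    also have "\<dots> \<le> L_max n L * norm (x - y)" using Li by (intro mult_right_mono) auto
    finally show "norm (gradient ?X (f i) x - gradient ?X (f i) y) \<le> L_max n L * norm (x - y)" .
  qed
qed

section \<open>Gradient complexity\<close>

lemma gradient_evaluations_eq:
  "real (gradient_evaluations n m1 S) = real n * real S + 2 * real m1 * (2 ^ S - 1)"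
  by (induction S) (simp_all add: gradient_evaluations_def stage_length_def algebra_simps)

text \<open>The least \<open>S\<close> will do for which \<open>K/\<epsilon> \<le> 2\<^sup>S\<close>: \<open>K \<ge> 1\<close> and \<open>\<epsilon> \<le> 1/2\<close> give
  \<open>S \<ge> 1\<close>, and \<open>ln 2 \<le> ln (1/\<epsilon>)\<close> absorbs the additive constants.\<close>

lemma stage_count:
  fixes K \<epsilon> :: real
  assumes K: "K \<ge> 1" and \<epsilon>: "0 < \<epsilon>" "\<epsilon> \<le> 1 / 2"
  obtains S :: nat where "S \<ge> 1" "K / \<epsilon> \<le> 2 ^ S" "2 ^ S \<le> 2 * K / \<epsilon>"
    "real S \<le> (ln (2 * K) / ln 2 + 1) / ln 2 * ln (1 / \<epsilon>)"
proof -
  have "\<exists>S. K / \<epsilon> \<le> 2 ^ S" using real_arch_pow[of 2 "K / \<epsilon>"] by (auto intro: less_imp_le)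
  define S where "S = (LEAST S. K / \<epsilon> \<le> 2 ^ S)"
  have S: "K / \<epsilon> \<le> 2 ^ S"
    unfolding S_def by (rule LeastI_ex) fact
  have "2 \<le> K / \<epsilon>" using K \<epsilon> by (simp add: field_simps)
  then have S1: "S \<ge> 1" using S by (cases S) auto
  then have "2 ^ (S - 1) < K / \<epsilon>"
    using not_less_Least[of "S - 1" "\<lambda>S. K / \<epsilon> \<le> 2 ^ S"] by (simp add: S_def)
  moreover have "(2::real) ^ S = 2 * 2 ^ (S - 1)" using S1 by (cases S) auto
  ultimately have S2: "2 ^ S \<le> 2 * K / \<epsilon>" by simp
  have "real S * ln 2 = ln (2 ^ S)" by (simp add: ln_realpow)
  also have "\<dots> \<le> ln (2 * K / \<epsilon>)" using S2 by (intro ln_mono) auto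
  also have "\<dots> = ln (2 * K) + ln (1 / \<epsilon>)" using K \<epsilon> by (simp add: ln_div)
  also have "\<dots> \<le> ln (2 * K) / ln 2 * ln (1 / \<epsilon>) + ln (1 / \<epsilon>)"
  proof -
    have "ln 2 \<le> ln (1 / \<epsilon>)" using \<epsilon> by (intro ln_mono) (auto simp: field_simps)
    then have "ln (2 * K) / ln 2 * ln 2 \<le> ln (2 * K) / ln 2 * ln (1 / \<epsilon>)"
      using K by (intro mult_left_mono) auto
    then show ?thesis by simp
  qed
  finally have "real S * ln 2 \<le> (ln (2 * K) / ln 2 + 1) * ln (1 / \<epsilon>)" by (simp add: distrib_right)
  then have "real S \<le> (ln (2 * K) / ln 2 + 1) / ln 2 * ln (1 / \<epsilon>)" by (simp add: field_simps)
  with S1 S S2 show thesis by (rule that)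
qed

lemma complexity_bound:
  fixes K L c \<epsilon> :: real
  assumes K: "K \<ge> 1" and L: "L > 0" and m1: "real m1 \<le> c * L" and \<epsilon>: "0 < \<epsilon>" "\<epsilon> \<le> 1 / 2"
    and c: "c \<ge> 0"
  shows "\<exists>S\<ge>1. K / 2 ^ S \<le> \<epsilon> \<and> real (gradient_evaluations n m1 S)
    \<le> ((ln (2 * K) / ln 2 + 1) / ln 2 + 4 * c * K) * (real n * ln (1 / \<epsilon>) + L / \<epsilon>)"
proof -
  define A where "A = (ln (2 * K) / ln 2 + 1) / ln 2"
  obtain S :: nat where S: "S \<ge> 1" "K / \<epsilon> \<le> 2 ^ S" "2 ^ S \<le> 2 * K / \<epsilon>" "real S \<le> A * ln (1 / \<epsilon>)"
    unfolding A_def by (rule stage_count[OF K \<epsilon>])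
  have "K / 2 ^ S \<le> \<epsilon>" using S(2) \<epsilon> by (simp add: field_simps)
  moreover have "real (gradient_evaluations n m1 S) \<le> (A + 4 * c * K) * (real n * ln (1 / \<epsilon>) + L / \<epsilon>)"
  proof -
    have "0 \<le> A" "0 \<le> ln (1 / \<epsilon>)" using K \<epsilon> by (simp_all add: A_def)
    then have cross: "0 \<le> A * (L / \<epsilon>)" "0 \<le> 4 * c * K * (real n * ln (1 / \<epsilon>))"
      using K L \<epsilon> c by simp_all
    have "real (gradient_evaluations n m1 S) \<le> real n * real S + 2 * real m1 * 2 ^ S"
      unfolding gradient_evaluations_eq by (simp add: right_diff_distrib)
    also have "\<dots> \<le> real n * (A * ln (1 / \<epsilon>)) + 2 * (c * L) * (2 * K / \<epsilon>)"
      using S m1 c L by (intro add_mono mult_mono) auto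
    also have "\<dots> = A * (real n * ln (1 / \<epsilon>)) + 4 * c * K * (L / \<epsilon>)" by simp
    also have "\<dots> \<le> (A + 4 * c * K) * (real n * ln (1 / \<epsilon>) + L / \<epsilon>)"
      using cross unfolding distrib_left distrib_right by linarith
    finally show ?thesis .
  qed
  ultimately show ?thesis using S(1) unfolding A_def by blast
qed

theorem corollary5p6:
  shows
  "(\<forall>(d::nat) (n::nat) f L R (\<mu>::real) x_star x_init (m1::nat) (S::nat).
      composite_problem (euclidean_nspace d) n f L R \<mu> x_star \<and> x_init \<in> euclidean_nspace d \<and> m1 \<ge> 1 \<and> S \<ge> 1 \<longrightarrow>
      expected_gap (euclidean_nspace d) n f R (5 * L_max n L) m1 0 x_init x_star S
        \<le> 1 / 2 ^ S * (objective n f R x_init - objective n f R x_star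
                        + 5 * L_max n L / real m1 * (norm (x_init - x_star))\<^sup>2))
   \<and>
   (\<forall>(c::real) (D::real). \<exists>C::real.
      \<forall>(d::nat) (n::nat) f L R (\<mu>::real) x_star x_init (m1::nat).
        composite_problem (euclidean_nspace d) n f L R \<mu> x_star \<and> x_init \<in> euclidean_nspace d \<and> m1 \<ge> 1 \<and>
        real m1 \<le> c * L_max n L \<and>
        D = objective n f R x_init - objective n f R x_star
              + 5 * L_max n L / real m1 * (norm (x_init - x_star))\<^sup>2 \<longrightarrow>
        (\<forall>\<epsilon>::real. 0 < \<epsilon> \<and> \<epsilon> \<le> 1 / 2 \<longrightarrow>
          (\<exists>S\<ge>1.
             expected_gap (euclidean_nspace d) n f R (5 * L_max n L) m1 0 x_init x_star S \<le> \<epsilon> \<and>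
             real (gradient_evaluations n m1 S) \<le> C * (real n * ln (1 / \<epsilon>) + L_max n L / \<epsilon>))))"
  (is "?rate \<and> (\<forall>c D. ?complexity c D)")
proof (rule conjI[OF _ allI[OF allI]])
  show ?rate
    using composite.expected_gap_bound[OF composite_problem_imp_composite] by blast
next
  fix c D :: real
  \<comment> \<open>at least \<open>1\<close>, so that the logarithm in the constant is positive\<close>
  define K where "K = 1 + \<bar>D\<bar>"
  show "?complexity c D"
  proof (intro exI[of _ "(ln (2 * K) / ln 2 + 1) / ln 2 + 4 * c * K"] allI impI, elim conjE)
    fix d n f L R \<mu> x_star x_init m1 and \<epsilon> :: real
    assume prob: "composite_problem (euclidean_nspace d) n f L R \<mu> x_star"
      and x_init: "x_init \<in> euclidean_nspace d" and m1: "1 \<le> m1" "real m1 \<le> c * L_max n L"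
      and D: "D = objective n f R x_init - objective n f R x_star
              + 5 * L_max n L / real m1 * (norm (x_init - x_star))\<^sup>2"
      and \<epsilon>: "0 < \<epsilon>" "\<epsilon> \<le> 1 / 2"
    have L: "L_max n L > 0" using prob by (simp add: composite_problem_def)
    have "0 < c * L_max n L" using m1 by linarith
    then have c: "c \<ge> 0" using L by (simp add: zero_less_mult_iff)
    obtain S where S: "S \<ge> 1" "K / 2 ^ S \<le> \<epsilon>"
      and evals: "real (gradient_evaluations n m1 S)
        \<le> ((ln (2 * K) / ln 2 + 1) / ln 2 + 4 * c * K) * (real n * ln (1 / \<epsilon>) + L_max n L / \<epsilon>)"
      using complexity_bound[of K "L_max n L" m1 c \<epsilon> n] L m1(2) \<epsilon> c by (auto simp: K_def)
    have "expected_gap (euclidean_nspace d) n f R (5 * L_max n L) m1 0 x_init x_star S \<le> 1 / 2 ^ S * D"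
      unfolding D by (rule composite.expected_gap_bound[OF composite_problem_imp_composite[OF prob] x_init m1(1)])
    also have "\<dots> \<le> K / 2 ^ S" by (simp add: K_def divide_right_mono)
    also have "\<dots> \<le> \<epsilon>" by (rule S)
    finally show "\<exists>S\<ge>1. expected_gap (euclidean_nspace d) n f R (5 * L_max n L) m1 0 x_init x_star S \<le> \<epsilon> \<and>
        real (gradient_evaluations n m1 S)
          \<le> ((ln (2 * K) / ln 2 + 1) / ln 2 + 4 * c * K) * (real n * ln (1 / \<epsilon>) + L_max n L / \<epsilon>)"
      using S(1) evals by blast
  qed
qed

end
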